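(* Let $p$ be a positive integer and let $\nu$ be a partition with at most $p$ nonzero parts. Suppose that for every partition $\alpha$ with at most $p$ nonzero parts and largest part $\alpha_1\le p(\nu_1+p)$, the symmetric function $s_{\lambda(\alpha,\nu)}s_{\rho(\alpha,\nu)}-s_\alpha s_\nu$ is Schur-positive. Then for every partition $\mu$ with at most $p$ nonzero parts, the symmetric function $s_{\lambda(\mu,\nu)}s_{\rho(\mu,\nu)}-s_\mu s_\nu$ is Schur-positive.
   Context: Partitions are weakly decreasing sequences of nonnegative integers, identified up to trailing zeros. For partitions $\mu,\nu$ choose $n\ge$ the number of nonzero parts of each and write $\mu=(\mu_1,\dots,\mu_n)$, $\nu=(\nu_1,\dots,\nu_n)$. The $*$-operation is $(\mu,\nu)^*=(\lambda(\mu,\nu),\rho(\mu,\nu))$ where, for $1\le k,j\le n$, $\lambda_k=\mu_k-k+\#\{j: \nu_j-j\ge \mu_k-k\}$ and $\rho_j=\nu_j-j+1+\#\{k:\mu_k-k>\nu_j-j\}$ (indices ranging over $\{1,\dots,n\}$); these are partitions, independent of $n$ up to trailing zeros. A symmetric function is Schur-positive if its expansion in the Schur basis $(s_\theta)$ has only nonnegative integer coefficients. *)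

theory Defs
  imports "HOL-Library.Poly_Mapping" "HOL-Library.FuncSet"
begin

section \<open>Partitions\<close>

text \<open>
  A partition is an infinite, weakly decreasing sequence of natural numbers with finitely many
  nonzero entries; this is the canonical representative modulo trailing zeros. Sequences are
  indexed from 0, so the part written \<open>\<mu>\<^sub>k\<close> with \<open>k \<ge> 1\<close> in the usual notation is \<open>\<mu> (k - 1)\<close> here; in
  particular the largest part is \<open>\<mu> 0\<close>.
\<close>

definition is_partition :: "(nat \<Rightarrow> nat) \<Rightarrow> bool" where
  "is_partition \<mu> \<longleftrightarrow> antimono \<mu> \<and> finite {i. \<mu> i \<noteq> 0}"

definition num_parts :: "(nat \<Rightarrow> nat) \<Rightarrow> nat" where
  "num_parts \<mu> = card {i. \<mu> i \<noteq> 0}"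

section \<open>The $*$-operation\<close>

text \<open>
  \<open>(\<mu>, \<nu>)\<^sup>* = (\<lambda>(\<mu>, \<nu>), \<rho>(\<mu>, \<nu>))\<close> is rendered as \<open>(star_left \<mu> \<nu>, star_right \<mu> \<nu>)\<close>. The index \<open>k\<close>
  stands for the 1-based index \<open>k + 1\<close>, which accounts for the successors. The integers passed to
  \<open>nat\<close> are never negative (\<open>star_left_value_nonneg\<close>, \<open>star_right_value_nonneg\<close>), so nothing is
  truncated.
\<close>

definition star_left_value :: "nat \<Rightarrow> (nat \<Rightarrow> nat) \<Rightarrow> (nat \<Rightarrow> nat) \<Rightarrow> nat \<Rightarrow> int" where
  "star_left_value n \<mu> \<nu> k = int (\<mu> k) - int (Suc k)
     + int (card {j. j < n \<and> int (\<nu> j) - int (Suc j) \<ge> int (\<mu> k) - int (Suc k)})"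

definition star_right_value :: "nat \<Rightarrow> (nat \<Rightarrow> nat) \<Rightarrow> (nat \<Rightarrow> nat) \<Rightarrow> nat \<Rightarrow> int" where
  "star_right_value n \<mu> \<nu> j = int (\<nu> j) - int (Suc j) + 1
     + int (card {k. k < n \<and> int (\<mu> k) - int (Suc k) > int (\<nu> j) - int (Suc j)})"

definition star_left_upto :: "nat \<Rightarrow> (nat \<Rightarrow> nat) \<Rightarrow> (nat \<Rightarrow> nat) \<Rightarrow> nat \<Rightarrow> nat" where
  "star_left_upto n \<mu> \<nu> k = (if k < n then nat (star_left_value n \<mu> \<nu> k) else 0)"

definition star_right_upto :: "nat \<Rightarrow> (nat \<Rightarrow> nat) \<Rightarrow> (nat \<Rightarrow> nat) \<Rightarrow> nat \<Rightarrow> nat" where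
  "star_right_upto n \<mu> \<nu> j = (if j < n then nat (star_right_value n \<mu> \<nu> j) else 0)"

text \<open>
  The smallest admissible \<open>n\<close> is chosen; by \<open>star_left_eq_upto\<close> and \<open>star_right_eq_upto\<close> every
  larger one gives the same partitions.
\<close>

definition star_left :: "(nat \<Rightarrow> nat) \<Rightarrow> (nat \<Rightarrow> nat) \<Rightarrow> nat \<Rightarrow> nat" where
  "star_left \<mu> \<nu> = star_left_upto (max (num_parts \<mu>) (num_parts \<nu>)) \<mu> \<nu>"

definition star_right :: "(nat \<Rightarrow> nat) \<Rightarrow> (nat \<Rightarrow> nat) \<Rightarrow> nat \<Rightarrow> nat" where
  "star_right \<mu> \<nu> = star_right_upto (max (num_parts \<mu>) (num_parts \<nu>)) \<mu> \<nu>"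

lemma star_left_value_nonneg:
  assumes "k < n"
  shows "star_left_value n \<mu> \<nu> k \<ge> 0"
proof (cases "\<mu> k \<le> k")
  case True
  have "{..<Suc (k - \<mu> k)} \<subseteq> {j. j < n \<and> int (\<nu> j) - int (Suc j) \<ge> int (\<mu> k) - int (Suc k)}"
    using assms True by auto
  from card_mono[OF _ this] have
    "Suc (k - \<mu> k) \<le> card {j. j < n \<and> int (\<nu> j) - int (Suc j) \<ge> int (\<mu> k) - int (Suc k)}"
    by simp
  then show ?thesis using True unfolding star_left_value_def by linarith
qed (simp add: star_left_value_def)

lemma star_right_value_nonneg:
  assumes "j < n"
  shows "star_right_value n \<mu> \<nu> j \<ge> 0"
proof (cases "\<nu> j \<le> j")
  case True
  have "{..<j - \<nu> j} \<subseteq> {k. k < n \<and> int (\<mu> k) - int (Suc k) > int (\<nu> j) - int (Suc j)}"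
    using assms True by auto
  from card_mono[OF _ this] have
    "j - \<nu> j \<le> card {k. k < n \<and> int (\<mu> k) - int (Suc k) > int (\<nu> j) - int (Suc j)}"
    by simp
  then show ?thesis using True unfolding star_right_value_def by linarith
qed (simp add: star_right_value_def)

lemma partition_nonzero_iff:
  assumes "is_partition \<mu>"
  shows "\<mu> i \<noteq> 0 \<longleftrightarrow> i < num_parts \<mu>"
proof -
  from assms have anti: "antimono \<mu>" and fin: "finite {i. \<mu> i \<noteq> 0}"
    by (auto simp: is_partition_def)
  have down: "\<mu> j \<noteq> 0" if "\<mu> i \<noteq> 0" "j \<le> i" for i j
    using antimonoD[OF anti that(2)] that(1) by simp
  obtain i0 where i0: "\<mu> i0 = 0"
    using fin ex_new_if_finite[of "{i. \<mu> i \<noteq> 0}"] by auto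
  define N where "N = (LEAST i. \<mu> i = 0)"
  have "\<mu> N = 0" unfolding N_def using i0 by (rule LeastI)
  moreover have "\<mu> j \<noteq> 0" if "j < N" for j
    using not_less_Least that unfolding N_def by blast
  ultimately have "\<And>i. \<mu> i \<noteq> 0 \<longleftrightarrow> i < N"
    using down by (metis not_less)
  then show ?thesis by (simp add: num_parts_def)
qed

lemma partition_eq_0:
  assumes "is_partition \<mu>" "num_parts \<mu> \<le> n"
  shows "\<mu> n = 0"
  using partition_nonzero_iff[OF assms(1), of n] assms(2) by auto

lemma star_upto_Suc:
  assumes "\<mu> n = 0" "\<nu> n = 0"
  shows "star_left_upto (Suc n) \<mu> \<nu> = star_left_upto n \<mu> \<nu>"
    and "star_right_upto (Suc n) \<mu> \<nu> = star_right_upto n \<mu> \<nu>"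
proof -
  have *: "star_left_value (Suc n) \<mu> \<nu> k = star_left_value n \<mu> \<nu> k" if "k < n" for k
  proof -
    have "{j. j < Suc n \<and> int (\<nu> j) - int (Suc j) \<ge> int (\<mu> k) - int (Suc k)}
        = {j. j < n \<and> int (\<nu> j) - int (Suc j) \<ge> int (\<mu> k) - int (Suc k)}"
      using assms that by (auto simp: less_Suc_eq)
    then show ?thesis by (simp add: star_left_value_def)
  qed
  have "{j. j < Suc n \<and> int (\<nu> j) - int (Suc j) \<ge> int (\<mu> n) - int (Suc n)} = {..<Suc n}"
    using assms by auto
  then have "star_left_value (Suc n) \<mu> \<nu> n = 0"
    using assms by (simp add: star_left_value_def)
  with * show "star_left_upto (Suc n) \<mu> \<nu> = star_left_upto n \<mu> \<nu>"
    by (auto simp: star_left_upto_def less_Suc_eq fun_eq_iff)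
  have *: "star_right_value (Suc n) \<mu> \<nu> j = star_right_value n \<mu> \<nu> j" if "j < n" for j
  proof -
    have "{k. k < Suc n \<and> int (\<mu> k) - int (Suc k) > int (\<nu> j) - int (Suc j)}
        = {k. k < n \<and> int (\<mu> k) - int (Suc k) > int (\<nu> j) - int (Suc j)}"
      using assms that by (auto simp: less_Suc_eq)
    then show ?thesis by (simp add: star_right_value_def)
  qed
  have "{k. k < Suc n \<and> int (\<mu> k) - int (Suc k) > int (\<nu> n) - int (Suc n)} = {..<n}"
    using assms by (auto simp: less_Suc_eq)
  then have "star_right_value (Suc n) \<mu> \<nu> n = 0"
    using assms by (simp add: star_right_value_def)
  with * show "star_right_upto (Suc n) \<mu> \<nu> = star_right_upto n \<mu> \<nu>"
    by (auto simp: star_right_upto_def less_Suc_eq fun_eq_iff)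
qed

lemma star_left_right_eq_upto:
  assumes "is_partition \<mu>" "is_partition \<nu>" "num_parts \<mu> \<le> n" "num_parts \<nu> \<le> n"
  shows "star_left_upto n \<mu> \<nu> = star_left \<mu> \<nu> \<and> star_right_upto n \<mu> \<nu> = star_right \<mu> \<nu>"
proof -
  from assms have "max (num_parts \<mu>) (num_parts \<nu>) \<le> n" by simp
  then show ?thesis
  proof (induction n rule: dec_induct)
    case base
    then show ?case by (simp add: star_left_def star_right_def)
  next
    case (step m)
    then have "\<mu> m = 0" "\<nu> m = 0"
      using partition_eq_0 assms by simp_all
    with step.IH show ?case by (simp add: star_upto_Suc)
  qed
qed

lemmas star_left_eq_upto = star_left_right_eq_upto[THEN conjunct1]
lemmas star_right_eq_upto = star_left_right_eq_upto[THEN conjunct2]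

lemma card_beta_interval:
  assumes "antimono \<nu>"
  shows "int (card {j. j < n \<and> int (\<nu> j) - int (Suc j) \<in> {b..<a}}) \<le> max 0 (a - b)"
proof -
  have less: "int (\<nu> j) - int (Suc j) < int (\<nu> i) - int (Suc i)" if "i < j" for i j
    using antimonoD[OF assms, of i j] that by simp
  have "inj_on (\<lambda>j. int (\<nu> j) - int (Suc j)) A" for A
    by (rule inj_onI) (metis less less_irrefl linorder_neqE_nat)
  then have "card {j. j < n \<and> int (\<nu> j) - int (Suc j) \<in> {b..<a}} \<le> card {b..<a}"
    by (intro card_inj_on_le[where f = "\<lambda>j. int (\<nu> j) - int (Suc j)"]) auto
  then show ?thesis by simp
qed

lemma star_left_value_antimono:
  assumes "antimono \<mu>" "antimono \<nu>"
  shows "star_left_value n \<mu> \<nu> (Suc k) \<le> star_left_value n \<mu> \<nu> k"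
proof -
  define f where "f j = int (\<nu> j) - int (Suc j)" for j
  define a where "a = int (\<mu> k) - int (Suc k)"
  define b where "b = int (\<mu> (Suc k)) - int (Suc (Suc k))"
  have "b < a" using antimonoD[OF assms(1), of k "Suc k"] by (simp add: a_def b_def)
  then have "{j. j < n \<and> f j \<ge> b} = {j. j < n \<and> f j \<ge> a} \<union> {j. j < n \<and> f j \<in> {b..<a}}"
    by auto
  then have "card {j. j < n \<and> f j \<ge> b}
      \<le> card {j. j < n \<and> f j \<ge> a} + card {j. j < n \<and> f j \<in> {b..<a}}"
    by (simp only: card_Un_le)
  moreover have "int (card {j. j < n \<and> f j \<in> {b..<a}}) \<le> a - b"
    using card_beta_interval[OF assms(2), of n b a] \<open>b < a\<close> by (simp add: f_def)
  ultimately show ?thesis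
    unfolding star_left_value_def f_def[symmetric] a_def[symmetric] b_def[symmetric] by linarith
qed

lemma star_right_value_antimono:
  assumes "antimono \<mu>" "antimono \<nu>"
  shows "star_right_value n \<mu> \<nu> (Suc k) \<le> star_right_value n \<mu> \<nu> k"
proof -
  define f where "f j = int (\<mu> j) - int (Suc j)" for j
  define a where "a = int (\<nu> k) - int (Suc k)"
  define b where "b = int (\<nu> (Suc k)) - int (Suc (Suc k))"
  have "b < a" using antimonoD[OF assms(2), of k "Suc k"] by (simp add: a_def b_def)
  then have "{j. j < n \<and> f j > b} = {j. j < n \<and> f j > a} \<union> {j. j < n \<and> f j \<in> {b + 1..<a + 1}}"
    by auto
  then have "card {j. j < n \<and> f j > b}
      \<le> card {j. j < n \<and> f j > a} + card {j. j < n \<and> f j \<in> {b + 1..<a + 1}}"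
    by (simp only: card_Un_le)
  moreover have "int (card {j. j < n \<and> f j \<in> {b + 1..<a + 1}}) \<le> a - b"
    using card_beta_interval[OF assms(1), of n "b + 1" "a + 1"] \<open>b < a\<close> by (simp add: f_def)
  ultimately show ?thesis
    unfolding star_right_value_def f_def[symmetric] a_def[symmetric] b_def[symmetric] by linarith
qed

lemma is_partition_star:
  assumes "is_partition \<mu>" "is_partition \<nu>"
  shows "is_partition (star_left \<mu> \<nu>)" and "is_partition (star_right \<mu> \<nu>)"
proof -
  have anti: "antimono \<mu>" "antimono \<nu>"
    using assms by (simp_all add: is_partition_def)
  show "is_partition (star_left \<mu> \<nu>)"
    unfolding is_partition_def star_left_def
  proof
    show "antimono (star_left_upto (max (num_parts \<mu>) (num_parts \<nu>)) \<mu> \<nu>)"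
      unfolding antimono_iff_le_Suc star_left_upto_def
      using star_left_value_antimono[OF anti] by (auto intro: nat_mono)
  qed (simp add: star_left_upto_def)
  show "is_partition (star_right \<mu> \<nu>)"
    unfolding is_partition_def star_right_def
  proof
    show "antimono (star_right_upto (max (num_parts \<mu>) (num_parts \<nu>)) \<mu> \<nu>)"
      unfolding antimono_iff_le_Suc star_right_upto_def
      using star_right_value_antimono[OF anti] by (auto intro: nat_mono)
  qed (simp add: star_right_upto_def)
qed

section \<open>Schur functions\<close>

text \<open>
  Symmetric functions live in the ring of formal power series over the integers in countably many
  variables \<open>x\<^sub>0, x\<^sub>1, \<dots>\<close>. A series is its coefficient function on monomials, a monomial being a
  finitely supported exponent vector. Addition and subtraction are pointwise (the library's
  instances for functions); the product is the Cauchy product below, a finite sum for each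
  monomial \<open>m\<close>.
\<close>

type_synonym series = "(nat \<Rightarrow>\<^sub>0 nat) \<Rightarrow> int"

definition series_mult :: "series \<Rightarrow> series \<Rightarrow> series" (infixl \<open>\<odot>\<close> 70) where
  "f \<odot> g = (\<lambda>m. \<Sum>(a, b)\<in>{(a, b). a + b = m}. f a * g b)"

lemma finite_monomial_splittings:
  fixes m :: "nat \<Rightarrow>\<^sub>0 nat"
  shows "finite {(a, b). a + b = m}"
proof -
  define N where "N = (\<Sum>v\<in>Poly_Mapping.keys m. Poly_Mapping.lookup m v)"
  define B where "B = {f :: nat \<Rightarrow> nat. \<forall>v. (v \<in> Poly_Mapping.keys m \<longrightarrow> f v \<in> {..N})
    \<and> (v \<notin> Poly_Mapping.keys m \<longrightarrow> f v = 0)}"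
  have "finite B" unfolding B_def by (rule finite_set_of_finite_funs) auto
  then have fin: "finite {a. Poly_Mapping.lookup a \<in> B}"
    by (rule finite_inverse_image) (simp add: inj_on_def lookup_inject)
  have in_B: "Poly_Mapping.lookup a \<in> B" if "a + b = m" for a b
  proof -
    have le: "Poly_Mapping.lookup a v \<le> Poly_Mapping.lookup m v" for v
      unfolding that[symmetric] lookup_add by (rule le_add1)
    have "Poly_Mapping.lookup m v \<le> N" if "v \<in> Poly_Mapping.keys m" for v
      unfolding N_def by (rule member_le_sum[OF that]) simp_all
    then have "Poly_Mapping.lookup a v \<le> N" if "v \<in> Poly_Mapping.keys m" for v
      using le[of v] le_trans that by blast
    moreover have "Poly_Mapping.lookup a v = 0" if "v \<notin> Poly_Mapping.keys m" for v
      using le[of v] that by (simp add: in_keys_iff)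
    ultimately show ?thesis by (simp add: B_def)
  qed
  have "Poly_Mapping.lookup b \<in> B" if "a + b = m" for a b
    using in_B[of b a] that by (simp add: add.commute)
  with in_B have "{(a, b). a + b = m}
      \<subseteq> {a. Poly_Mapping.lookup a \<in> B} \<times> {a. Poly_Mapping.lookup a \<in> B}"
    by blast
  then show ?thesis using finite_cartesian_product[OF fin fin] by (rule finite_subset)
qed

definition diagram :: "(nat \<Rightarrow> nat) \<Rightarrow> (nat \<times> nat) set" where
  "diagram \<mu> = {(i, j). j < \<mu> i}"

text \<open>
  Semistandard Young tableaux in English notation: cell \<open>(i, j)\<close> is in row \<open>i\<close> and column \<open>j\<close>, and
  an entry \<open>v\<close> contributes the variable \<open>x\<^sub>v\<close>. Extensionality makes a filling determined by its
  entries on the diagram, so that counting functions counts tableaux.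
\<close>

definition ssyt :: "(nat \<Rightarrow> nat) \<Rightarrow> (nat \<times> nat \<Rightarrow> nat) set" where
  "ssyt \<mu> = {T \<in> extensional (diagram \<mu>).
     (\<forall>i j j'. (i, j) \<in> diagram \<mu> \<longrightarrow> (i, j') \<in> diagram \<mu> \<longrightarrow> j < j' \<longrightarrow> T (i, j) \<le> T (i, j')) \<and>
     (\<forall>i i' j. (i, j) \<in> diagram \<mu> \<longrightarrow> (i', j) \<in> diagram \<mu> \<longrightarrow> i < i' \<longrightarrow> T (i, j) < T (i', j))}"

text \<open>
  The coefficient of the monomial \<open>m\<close> in \<open>s\<^sub>\<mu> = \<Sum>\<^sub>T x\<^sup>T\<close> is the number of tableaux of shape \<open>\<mu>\<close> in
  which each \<open>v\<close> occurs exactly \<open>lookup m v\<close> times.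
\<close>

definition ssyt_content :: "(nat \<Rightarrow> nat) \<Rightarrow> (nat \<Rightarrow>\<^sub>0 nat) \<Rightarrow> (nat \<times> nat \<Rightarrow> nat) set" where
  "ssyt_content \<mu> m =
     {T \<in> ssyt \<mu>. \<forall>v. card {c \<in> diagram \<mu>. T c = v} = Poly_Mapping.lookup m v}"

definition schur :: "(nat \<Rightarrow> nat) \<Rightarrow> series" where
  "schur \<mu> = (\<lambda>m. int (card (ssyt_content \<mu> m)))"

lemma finite_diagram:
  assumes "is_partition \<mu>"
  shows "finite (diagram \<mu>)"
proof -
  have "diagram \<mu> = (SIGMA i:{i. \<mu> i \<noteq> 0}. {..<\<mu> i})"
    by (auto simp: diagram_def)
  then show ?thesis using assms by (simp add: is_partition_def)
qed

lemma finite_ssyt_content: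
  assumes "is_partition \<mu>"
  shows "finite (ssyt_content \<mu> m)"
proof (rule finite_subset)
  have fin: "finite (diagram \<mu>)" using finite_diagram[OF assms] .
  show "ssyt_content \<mu> m \<subseteq> diagram \<mu> \<rightarrow>\<^sub>E Poly_Mapping.keys m"
  proof
    fix T assume T: "T \<in> ssyt_content \<mu> m"
    have "T c \<in> Poly_Mapping.keys m" if "c \<in> diagram \<mu>" for c
    proof -
      have "card {c' \<in> diagram \<mu>. T c' = T c} \<noteq> 0"
        using fin that by (cases c) auto
      then show ?thesis using T by (auto simp: ssyt_content_def in_keys_iff)
    qed
    then show "T \<in> diagram \<mu> \<rightarrow>\<^sub>E Poly_Mapping.keys m"
      using T by (auto simp: ssyt_content_def ssyt_def PiE_def)
  qed
  show "finite (diagram \<mu> \<rightarrow>\<^sub>E Poly_Mapping.keys m)" using fin by (intro finite_PiE) auto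
qed

definition schur_expansion :: "series \<Rightarrow> ((nat \<Rightarrow> nat) \<Rightarrow> int) \<Rightarrow> bool" where
  "schur_expansion f c \<longleftrightarrow>
     finite {\<theta>. c \<theta> \<noteq> 0} \<and> (\<forall>\<theta>. c \<theta> \<noteq> 0 \<longrightarrow> is_partition \<theta>) \<and>
     f = (\<lambda>m. \<Sum>\<theta> | c \<theta> \<noteq> 0. c \<theta> * schur \<theta> m)"

definition schur_positive :: "series \<Rightarrow> bool" where
  "schur_positive f \<longleftrightarrow> (\<exists>c. schur_expansion f c \<and> (\<forall>\<theta>. c \<theta> \<ge> 0))"

end

theory Submission
  imports Defs "Jordan_Normal_Form.Determinant"
begin

text \<open>
  If \<open>\<mu>\<^sub>1 > p (\<nu>\<^sub>1 + p)\<close>, then \<open>\<mu>\<^sub>k - \<mu>\<^sub>k\<^sub>+\<^sub>1 > \<nu>\<^sub>1 + p\<close> for some \<open>k \<le> p\<close>. Removing a column of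
  length \<open>k\<close> from \<open>\<mu>\<close> then removes a column of length \<open>k\<close> from \<open>\<lambda>(\<mu>, \<nu>)\<close> and leaves \<open>\<rho>(\<mu>, \<nu>)\<close>
  unchanged. By the Littlewood--Richardson rule the coefficient of \<open>s\<^sub>\<theta>\<close> in \<open>s\<^sub>\<sigma> s\<^sub>\<rho>\<close> counts the
  tableaux \<open>T\<close> of shape \<open>\<rho>\<close> and content \<open>\<theta> - \<sigma>\<close> such that \<open>\<sigma>\<close> plus the content of any final set
  of columns of \<open>T\<close> is a partition. Adding a column of length \<open>k\<close> to \<open>\<sigma>\<close> and \<open>\<theta>\<close> can only
  enlarge this set of tableaux, and it does not change the set when \<open>\<sigma>\<^sub>k - \<sigma>\<^sub>k\<^sub>+\<^sub>1 \<ge> \<rho>\<^sub>1\<close>. So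
  the coefficients of \<open>s\<^sub>\<lambda> s\<^sub>\<rho>\<close> weakly increase while those of \<open>s\<^sub>\<mu> s\<^sub>\<nu>\<close> stay the same, and
  induction on \<open>\<mu>\<^sub>1\<close> applies.

  The Littlewood--Richardson rule is obtained from Stembridge's sign-reversing involution on the
  alternants \<open>det (x\<^sub>i\<^bsup>\<gamma> j\<^esup>)\<close>, with tableaux encoded as Gelfand--Tsetlin patterns; the
  bialternant formula follows from the branching rule for both sides.
\<close>

section \<open>Gelfand--Tsetlin patterns\<close>

definition interlaces :: "(nat \<Rightarrow> nat) \<Rightarrow> (nat \<Rightarrow> nat) \<Rightarrow> bool" where
  "interlaces \<kappa> \<theta> \<longleftrightarrow> (\<forall>r. \<theta> (Suc r) \<le> \<kappa> r \<and> \<kappa> r \<le> \<theta> r)"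

text \<open>
  The rows \<open>g 0 \<subseteq> g 1 \<subseteq> \<dots> \<subseteq> g n = \<theta>\<close> are the shapes formed by the entries less than \<open>0, 1, \<dots>, n\<close>
  of a semistandard tableau of shape \<open>\<theta>\<close>.
\<close>

definition gt_patterns :: "nat \<Rightarrow> (nat \<Rightarrow> nat) \<Rightarrow> (nat \<Rightarrow> nat \<Rightarrow> nat) set" where
  "gt_patterns n \<theta> = {g. g 0 = (\<lambda>_. 0) \<and> (\<forall>v<n. interlaces (g v) (g (Suc v))) \<and> (\<forall>v\<ge>n. g v = \<theta>)}"

text \<open>
  The number of entries \<open>v\<close> in the columns \<open>j, j + 1, \<dots>\<close> of the tableau; they all lie in the
  rows \<open>0, \<dots>, v\<close>. The two inner truncated subtractions remove the first \<open>j\<close> columns.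
\<close>

definition weight_from :: "(nat \<Rightarrow> nat \<Rightarrow> nat) \<Rightarrow> nat \<Rightarrow> nat \<Rightarrow> nat" where
  "weight_from g j v = (\<Sum>r\<le>v. (g (Suc v) r - j) - (g v r - j))"

abbreviation gt_weight :: "(nat \<Rightarrow> nat \<Rightarrow> nat) \<Rightarrow> nat \<Rightarrow> nat" where
  "gt_weight g \<equiv> weight_from g 0"

lemma gt_patterns_interlaces:
  assumes "g \<in> gt_patterns n \<theta>" "v < n"
  shows "interlaces (g v) (g (Suc v))"
  using assms by (auto simp: gt_patterns_def)

lemma gt_patterns_le_Suc:
  assumes "g \<in> gt_patterns n \<theta>"
  shows "g v r \<le> g (Suc v) r"
  using assms by (cases "v < n") (auto simp: gt_patterns_def interlaces_def)

lemma gt_patterns_mono: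
  assumes "g \<in> gt_patterns n \<theta>" "v \<le> v'"
  shows "g v r \<le> g v' r"
  using assms(2) by (rule lift_Suc_mono_le[of "\<lambda>v. g v r", OF gt_patterns_le_Suc[OF assms(1)]])

lemma gt_patterns_le_shape:
  assumes "g \<in> gt_patterns n \<theta>"
  shows "g v r \<le> \<theta> r"
  using gt_patterns_mono[OF assms, of v "max v n" r] assms by (auto simp: gt_patterns_def)

text \<open>Column strictness: a column whose entries are all below \<open>v\<close> has at most
  \<open>v\<close> cells. Hence weights may be summed over any range of rows that reaches past
  \<open>v\<close>.\<close>

lemma gt_patterns_eq_0:
  assumes "g \<in> gt_patterns n \<theta>" "v \<le> r"
  shows "g v r = 0"
  using assms(2)
proof (induction v arbitrary: r)
  case 0
  then show ?case using assms(1) by (simp add: gt_patterns_def)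
next
  case (Suc v)
  then obtain r' where r': "r = Suc r'" "v \<le> r'" by (cases r) auto
  show ?case
  proof (cases "v < n")
    case True
    with gt_patterns_interlaces[OF assms(1)] have "g (Suc v) r \<le> g v r'"
      by (auto simp: interlaces_def r')
    with Suc.IH[OF r'(2)] show ?thesis by simp
  next
    case False
    with assms(1) have "g (Suc v) = g v" by (simp add: gt_patterns_def)
    with Suc show ?thesis by simp
  qed
qed

text \<open>From stage \<open>n\<close> on the pattern is constant and the inequality becomes
  monotonicity of \<open>\<theta>\<close>, so it is available at every stage.\<close>

lemma gt_patterns_interlaces_left:
  assumes "g \<in> gt_patterns n \<theta>" "antimono \<theta>"
  shows "g (Suc v) (Suc r) \<le> g v r"
  using assms by (cases "v < n") (auto simp: gt_patterns_def interlaces_def antimono_iff_le_Suc)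

lemma gt_patterns_antimono:
  assumes "g \<in> gt_patterns n \<theta>" "antimono \<theta>"
  shows "antimono (g v)"
  unfolding antimono_iff_le_Suc
  using le_trans[OF gt_patterns_le_Suc[OF assms(1)] gt_patterns_interlaces_left[OF assms]] by simp

lemma weight_from_upto:
  assumes "g \<in> gt_patterns n \<theta>" "v < N"
  shows "weight_from g j v = (\<Sum>r<N. (g (Suc v) r - j) - (g v r - j))"
  unfolding weight_from_def
  using assms by (intro sum.mono_neutral_left) (auto simp: gt_patterns_eq_0[OF assms(1)])

lemma weight_from_eq_0:
  assumes "g \<in> gt_patterns n \<theta>" "n \<le> v"
  shows "weight_from g j v = 0"
  using assms by (auto simp: gt_patterns_def weight_from_def)

lemma weight_from_large:
  assumes "g \<in> gt_patterns n \<theta>" "antimono \<theta>" "\<theta> 0 \<le> j"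
  shows "weight_from g j v = 0"
proof -
  have "g (Suc v) r \<le> j" for r
    using gt_patterns_le_shape[OF assms(1), of "Suc v" r] antimonoD[OF assms(2), of 0 r] assms(3)
    by simp
  then show ?thesis by (simp add: weight_from_def)
qed

text \<open>Branching: deleting the entries \<open>n\<close> from a tableau leaves a tableau with
  entries below \<open>n\<close> on an interlaced shape \<open>\<kappa>\<close>. Column strictness
  makes \<open>\<kappa>\<close> vanish from row \<open>n\<close> on, which keeps the index set
  finite.\<close>

lemma gt_patterns_Suc:
  "gt_patterns (Suc n) \<theta> =
    (\<lambda>(\<kappa>, g) v. if v \<le> n then g v else \<theta>) `
      (SIGMA \<kappa>:{\<kappa>. interlaces \<kappa> \<theta> \<and> (\<forall>r\<ge>n. \<kappa> r = 0)}. gt_patterns n \<kappa>)" (is "?L = ?f ` ?R")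
proof (intro Set.set_eqI iffI)
  fix g assume g: "g \<in> ?L"
  define g' where "g' = (\<lambda>v. if v \<le> n then g v else g n)"
  have "g' \<in> gt_patterns n (g n)"
    using g by (auto simp: gt_patterns_def g'_def)
  moreover have "interlaces (g n) \<theta>"
    using g by (auto simp: gt_patterns_def)
  moreover have "g n r = 0" if "n \<le> r" for r
    using gt_patterns_eq_0[OF g that] .
  moreover have "g = ?f (g n, g')"
    using g by (auto simp: g'_def gt_patterns_def fun_eq_iff)
  ultimately show "g \<in> ?f ` ?R" by blast
next
  fix g assume "g \<in> ?f ` ?R"
  then obtain \<kappa> g' where *: "interlaces \<kappa> \<theta>" "g' \<in> gt_patterns n \<kappa>" "g = ?f (\<kappa>, g')" by auto
  have "interlaces (g v) (g (Suc v))" if "v < Suc n" for v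
    using * that by (cases "v = n") (auto simp: gt_patterns_def)
  then show "g \<in> ?L" using * by (auto simp: gt_patterns_def)
qed

lemma inj_on_gt_patterns_Suc:
  "inj_on (\<lambda>(\<kappa>, g) v. if v \<le> n then g v else \<theta>) (SIGMA \<kappa>:A. gt_patterns n \<kappa>)"
proof (rule inj_onI, clarify)
  fix \<kappa> g \<kappa>' g'
  assume *: "g \<in> gt_patterns n \<kappa>" "g' \<in> gt_patterns n \<kappa>'"
    and eq: "(\<lambda>v. if v \<le> n then g v else \<theta>) = (\<lambda>v. if v \<le> n then g' v else \<theta>)"
  have le: "g v = g' v" if "v \<le> n" for v using fun_cong[OF eq, of v] that by simp
  then have "\<kappa> = \<kappa>'" using * by (auto simp: gt_patterns_def)
  moreover have "g v = g' v" for v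
    using le[of v] * \<open>\<kappa> = \<kappa>'\<close> by (cases "v \<le> n") (auto simp: gt_patterns_def)
  ultimately show "\<kappa> = \<kappa>' \<and> g = g'" by auto
qed

lemma gt_patterns_0:
  "gt_patterns 0 \<theta> = (if \<theta> = (\<lambda>_. 0) then {\<lambda>_ _. 0} else {})"
  by (auto simp: gt_patterns_def)

lemma finite_interlaced:
  "finite {\<kappa>. interlaces \<kappa> \<theta> \<and> (\<forall>r\<ge>n. \<kappa> r = 0)}" (is "finite ?A")
proof (rule finite_subset)
  show "finite {f :: nat \<Rightarrow> nat. \<forall>r. (r \<in> {..<n} \<longrightarrow> f r \<in> {..sum \<theta> {..<n}}) \<and> (r \<notin> {..<n} \<longrightarrow> f r = 0)}"
    by (rule finite_set_of_finite_funs) auto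
  have "\<kappa> r \<le> sum \<theta> {..<n}" if "interlaces \<kappa> \<theta>" "r < n" for \<kappa> r
    using that member_le_sum[of r "{..<n}" \<theta>] by (auto simp: interlaces_def intro: le_trans)
  then show "?A \<subseteq> {f. \<forall>r. (r \<in> {..<n} \<longrightarrow> f r \<in> {..sum \<theta> {..<n}}) \<and> (r \<notin> {..<n} \<longrightarrow> f r = 0)}"
    by auto
qed

lemma finite_gt_patterns: "finite (gt_patterns n \<theta>)"
proof (induction n arbitrary: \<theta>)
  case 0
  then show ?case by (simp add: gt_patterns_0)
next
  case (Suc n)
  then show ?case unfolding gt_patterns_Suc
    by (intro finite_imageI finite_SigmaI finite_interlaced)
qed

section \<open>Bijection between semistandard tableaux and patterns\<close>

definition pattern_of :: "(nat \<Rightarrow> nat) \<Rightarrow> (nat \<times> nat \<Rightarrow> nat) \<Rightarrow> nat \<Rightarrow> nat \<Rightarrow> nat" where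
  "pattern_of \<theta> T v r = card {c. c < \<theta> r \<and> T (r, c) < v}"

text \<open>A cell that joins the shape between the stages \<open>v\<close> and \<open>Suc v\<close>
  carries the entry \<open>v\<close>; hence the successor.\<close>

definition tableau_of :: "(nat \<Rightarrow> nat) \<Rightarrow> (nat \<Rightarrow> nat \<Rightarrow> nat) \<Rightarrow> nat \<times> nat \<Rightarrow> nat" where
  "tableau_of \<theta> g = restrict (\<lambda>(r, c). LEAST v. c < g (Suc v) r) (diagram \<theta>)"

text \<open>Rows increase weakly, so the columns with entry below \<open>v\<close> form an initial
  segment and its cardinality acts as a threshold.\<close>

lemma less_pattern_of_iff:
  assumes "T \<in> ssyt \<theta>"
  shows "c < pattern_of \<theta> T v r \<longleftrightarrow> c < \<theta> r \<and> T (r, c) < v"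
proof -
  let ?S = "{c. c < \<theta> r \<and> T (r, c) < v}"
  have down: "c \<in> ?S" if "c' \<in> ?S" "c \<le> c'" for c c'
  proof (cases "c = c'")
    case False
    with that assms have "T (r, c) \<le> T (r, c')" by (auto simp: ssyt_def diagram_def)
    with that show ?thesis by auto
  qed (use that in simp)
  have "\<exists>N. ?S = {..<N}"
  proof -
    define N where "N = (LEAST c. c \<notin> ?S)"
    have "\<theta> r \<notin> ?S" by simp
    then have "N \<notin> ?S" unfolding N_def by (rule LeastI)
    moreover have "c \<in> ?S" if "c < N" for c
      using not_less_Least that unfolding N_def by blast
    ultimately show ?thesis using down[of _ N] down
      by (intro exI[of _ N] Set.set_eqI iffI) (metis lessThan_iff not_less, blast)
  qed
  then obtain N where "?S = {..<N}" by blast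
  then show ?thesis unfolding pattern_of_def using card_lessThan[of N] by auto
qed

lemma tableau_of_less_iff:
  assumes "g \<in> gt_patterns n \<theta>" "c < \<theta> r"
  shows "tableau_of \<theta> g (r, c) < v \<longleftrightarrow> c < g v r"
proof -
  \<comment> \<open>Stage \<open>Suc n\<close> is the whole shape, so the \<open>LEAST\<close> is
    attained.\<close>
  have "c < g (Suc n) r" using assms by (simp add: gt_patterns_def)
  then have L: "c < g (Suc (LEAST v. c < g (Suc v) r)) r" by (rule LeastI)
  have eq: "tableau_of \<theta> g (r, c) = (LEAST v. c < g (Suc v) r)"
    using assms by (simp add: tableau_of_def diagram_def)
  show ?thesis
  proof
    assume "tableau_of \<theta> g (r, c) < v"
    with L gt_patterns_mono[OF assms(1), of "Suc (LEAST v. c < g (Suc v) r)" v r]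
    show "c < g v r" unfolding eq by simp
  next
    assume c: "c < g v r"
    then obtain v' where v: "v = Suc v'" using assms by (cases v) (auto simp: gt_patterns_def)
    with c have "(LEAST v. c < g (Suc v) r) \<le> v'" by (intro Least_le) simp
    then show "tableau_of \<theta> g (r, c) < v" unfolding eq v by simp
  qed
qed

text \<open>Rows increase weakly because each stage meets a row in an initial segment. Strictness
  down the columns is left interlacing: a cell above an entry \<open>v\<close> already belongs to
  stage \<open>v\<close>.\<close>

lemma tableau_of_ssyt:
  assumes g: "g \<in> gt_patterns n \<theta>" and \<theta>: "antimono \<theta>"
  shows "tableau_of \<theta> g \<in> ssyt \<theta>"
proof -
  have "tableau_of \<theta> g (r, c) \<le> tableau_of \<theta> g (r, c')" if "c' < \<theta> r" "c < c'" for r c c'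
    using tableau_of_less_iff[OF g, of c' r "Suc (tableau_of \<theta> g (r, c'))"]
      tableau_of_less_iff[OF g, of c r "Suc (tableau_of \<theta> g (r, c'))"] that
    by auto
  moreover have "tableau_of \<theta> g (r, c) < tableau_of \<theta> g (r', c)"
    if "c < \<theta> r" "c < \<theta> r'" "r < r'" for r r' c
  proof -
    let ?v = "tableau_of \<theta> g (r', c)"
    have "c < g (Suc ?v) r'" using tableau_of_less_iff[OF g, of c r' "Suc ?v"] that by simp
    also have "\<dots> \<le> g (Suc ?v) (Suc r)"
      by (rule antimonoD[OF gt_patterns_antimono[OF g \<theta>]]) (use that in simp)
    also have "\<dots> \<le> g ?v r" by (rule gt_patterns_interlaces_left[OF g \<theta>])
    finally show ?thesis using tableau_of_less_iff[OF g, of c r ?v] that by simp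
  qed
  ultimately show ?thesis by (auto simp: ssyt_def diagram_def tableau_of_def)
qed

text \<open>In row \<open>r\<close> the entries \<open>v\<close> occupy the columns from
  \<open>g v r\<close> up to \<open>g (Suc v) r\<close>. The filling \<open>T\<close> is kept
  arbitrary so that both directions of the bijection can use the count.\<close>

lemma card_value_eq_weight:
  assumes g: "g \<in> gt_patterns n \<theta>"
    and T: "\<And>r c v. c < \<theta> r \<Longrightarrow> T (r, c) < v \<longleftrightarrow> c < g v r"
  shows "card {c \<in> diagram \<theta>. T c = v} = gt_weight g v"
proof -
  have iff: "T (r, c) = v \<longleftrightarrow> g v r \<le> c \<and> c < g (Suc v) r" if "c < \<theta> r" for r c
    using T[OF that, of v] T[OF that, of "Suc v"] by auto
  have "{c \<in> diagram \<theta>. T c = v} = (SIGMA r:{..v}. {g v r..<g (Suc v) r})"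
  proof (intro Set.set_eqI iffI)
    fix x assume "x \<in> {c \<in> diagram \<theta>. T c = v}"
    then obtain r c where x: "x = (r, c)" "c < \<theta> r" "T (r, c) = v"
      by (cases x) (auto simp: diagram_def)
    then have *: "g v r \<le> c" "c < g (Suc v) r" using iff by auto
    then have "r \<le> v" using gt_patterns_eq_0[OF g, of "Suc v" r] by (cases "r \<le> v") auto
    with * x show "x \<in> (SIGMA r:{..v}. {g v r..<g (Suc v) r})" by auto
  next
    fix x assume "x \<in> (SIGMA r:{..v}. {g v r..<g (Suc v) r})"
    then obtain r c where x: "x = (r, c)" "g v r \<le> c" "c < g (Suc v) r" by auto
    then have "c < \<theta> r" using gt_patterns_le_shape[OF g, of "Suc v" r] by simp
    with x iff show "x \<in> {c \<in> diagram \<theta>. T c = v}" by (auto simp: diagram_def)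
  qed
  then show ?thesis by (simp add: weight_from_def)
qed

lemma pattern_of_gt:
  assumes T: "T \<in> ssyt \<theta>" and \<theta>: "antimono \<theta>" and lt: "\<And>c. c \<in> diagram \<theta> \<Longrightarrow> T c < n"
  shows "pattern_of \<theta> T \<in> gt_patterns n \<theta>"
proof -
  have "pattern_of \<theta> T v r = \<theta> r" if "n \<le> v" for v r
  proof -
    have "c < pattern_of \<theta> T v r \<longleftrightarrow> c < \<theta> r" for c
      using lt[of "(r, c)"] that by (auto simp: less_pattern_of_iff[OF T] diagram_def)
    then show ?thesis by (metis linorder_neqE_nat less_irrefl)
  qed
  \<comment> \<open>Column strictness: above an entry that is at most \<open>v\<close> stands an
    entry below \<open>v\<close>.\<close>
  moreover have "pattern_of \<theta> T (Suc v) (Suc r) \<le> pattern_of \<theta> T v r" for v r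
  proof (rule ccontr)
    assume "\<not> ?thesis"
    then obtain c where c: "c < pattern_of \<theta> T (Suc v) (Suc r)" "\<not> c < pattern_of \<theta> T v r"
      by (metis less_irrefl not_le)
    from c(1) have "c < \<theta> (Suc r)" "T (Suc r, c) < Suc v"
      by (auto simp: less_pattern_of_iff[OF T])
    moreover from this have "c < \<theta> r" using antimonoD[OF \<theta>, of r "Suc r"] by simp
    moreover from calculation have "T (r, c) < T (Suc r, c)"
      using T by (auto simp: ssyt_def diagram_def)
    ultimately show False using c(2) by (auto simp: less_pattern_of_iff[OF T])
  qed
  moreover have "pattern_of \<theta> T v r \<le> pattern_of \<theta> T (Suc v) r" for v r
    unfolding pattern_of_def by (intro card_mono) auto
  ultimately show ?thesis
    by (auto simp: gt_patterns_def interlaces_def pattern_of_def[abs_def])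
qed

text \<open>If \<open>m\<close> involves only variables below \<open>n\<close>, every entry of a
  tableau of content \<open>m\<close> is below \<open>n\<close>. This is the passage from infinitely
  many variables to \<open>n\<close> of them.\<close>

lemma schur_eq_card_gt_patterns:
  assumes \<theta>: "is_partition \<theta>" and m: "Poly_Mapping.keys m \<subseteq> {..<n}"
  shows "schur \<theta> m = int (card {g \<in> gt_patterns n \<theta>. gt_weight g = Poly_Mapping.lookup m})"
proof -
  have anti: "antimono \<theta>" using \<theta> by (simp add: is_partition_def)
  have "bij_betw (pattern_of \<theta>) (ssyt_content \<theta> m)
     {g \<in> gt_patterns n \<theta>. gt_weight g = Poly_Mapping.lookup m}"
  proof (rule bij_betw_byWitness[where f' = "tableau_of \<theta>"])
    have ssyt: "T \<in> ssyt \<theta>" if "T \<in> ssyt_content \<theta> m" for T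
      using that by (simp add: ssyt_content_def)
    have gt: "pattern_of \<theta> T \<in> gt_patterns n \<theta>" if T: "T \<in> ssyt_content \<theta> m" for T
    proof (rule pattern_of_gt[OF ssyt[OF T] anti])
      fix c assume "c \<in> diagram \<theta>"
      then have "card {c' \<in> diagram \<theta>. T c' = T c} \<noteq> 0"
        using finite_diagram[OF \<theta>] by (cases c) auto
      then have "T c \<in> Poly_Mapping.keys m" using T by (auto simp: ssyt_content_def in_keys_iff)
      then show "T c < n" using m by auto
    qed
    show "\<forall>T\<in>ssyt_content \<theta> m. tableau_of \<theta> (pattern_of \<theta> T) = T"
    proof
      fix T assume T: "T \<in> ssyt_content \<theta> m"
      have "tableau_of \<theta> (pattern_of \<theta> T) (r, c) = T (r, c)" for r c
      proof (cases "c < \<theta> r")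
        case True
        then have "tableau_of \<theta> (pattern_of \<theta> T) (r, c) < v \<longleftrightarrow> T (r, c) < v" for v
          using tableau_of_less_iff[OF gt[OF T]] less_pattern_of_iff[OF ssyt[OF T]] by blast
        then show ?thesis by (metis linorder_neqE_nat less_irrefl)
      next
        case False
        then show ?thesis using ssyt[OF T]
          by (auto simp: tableau_of_def ssyt_def extensional_def diagram_def)
      qed
      then show "tableau_of \<theta> (pattern_of \<theta> T) = T" by auto
    qed
    show "\<forall>g\<in>{g \<in> gt_patterns n \<theta>. gt_weight g = Poly_Mapping.lookup m}.
        pattern_of \<theta> (tableau_of \<theta> g) = g"
    proof clarify
      fix g assume g: "g \<in> gt_patterns n \<theta>"
      have "c < pattern_of \<theta> (tableau_of \<theta> g) v r \<longleftrightarrow> c < g v r" for c v r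
        using tableau_of_less_iff[OF g] less_pattern_of_iff[OF tableau_of_ssyt[OF g anti]]
          gt_patterns_le_shape[OF g, of v r] by (metis order_less_le_trans)
      then show "pattern_of \<theta> (tableau_of \<theta> g) = g"
        by (intro ext) (metis linorder_neqE_nat less_irrefl)
    qed
    show "pattern_of \<theta> ` ssyt_content \<theta> m
        \<subseteq> {g \<in> gt_patterns n \<theta>. gt_weight g = Poly_Mapping.lookup m}"
    proof clarify
      fix T assume T: "T \<in> ssyt_content \<theta> m"
      have "gt_weight (pattern_of \<theta> T) v = card {c \<in> diagram \<theta>. T c = v}" for v
        using less_pattern_of_iff[OF ssyt[OF T]]
        by (intro card_value_eq_weight[OF gt[OF T], symmetric]) auto
      then show "pattern_of \<theta> T \<in> gt_patterns n \<theta>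
          \<and> gt_weight (pattern_of \<theta> T) = Poly_Mapping.lookup m"
        using gt[OF T] T by (auto simp: ssyt_content_def)
    qed
    show "tableau_of \<theta> ` {g \<in> gt_patterns n \<theta>. gt_weight g = Poly_Mapping.lookup m}
        \<subseteq> ssyt_content \<theta> m"
    proof clarify
      fix g assume g: "g \<in> gt_patterns n \<theta>" and w: "gt_weight g = Poly_Mapping.lookup m"
      show "tableau_of \<theta> g \<in> ssyt_content \<theta> m"
        using tableau_of_ssyt[OF g anti] card_value_eq_weight[OF g tableau_of_less_iff[OF g]]
        by (simp add: ssyt_content_def w)
    qed
  qed
  then show ?thesis by (simp add: schur_def bij_betw_same_card)
qed

section \<open>Alternants and the bialternant formula\<close>

text \<open>The Vandermonde exponents \<open>n - 1, ..., 0\<close>. Truncated subtraction extends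
  them by zeros, so exponent vectors have support in \<open>{..<n}\<close>.\<close>

definition staircase :: "nat \<Rightarrow> nat \<Rightarrow> nat" where
  "staircase n j = n - Suc j"

text \<open>The Leibniz expansion of a generalized Vandermonde determinant. Alternants are treated
  as functions of real points; \<open>monomial_functions_independent\<close> later turns identities
  of functions into identities of coefficients.\<close>

definition alternant :: "nat \<Rightarrow> (nat \<Rightarrow> nat) \<Rightarrow> (nat \<Rightarrow> real) \<Rightarrow> real" where
  "alternant n \<gamma> x = (\<Sum>w | w permutes {..<n}. of_int (sign w) * (\<Prod>i<n. x i ^ \<gamma> (w i)))"

definition schur_poly :: "nat \<Rightarrow> (nat \<Rightarrow> nat) \<Rightarrow> (nat \<Rightarrow> real) \<Rightarrow> real" where
  "schur_poly n \<theta> x = (\<Sum>g\<in>gt_patterns n \<theta>. \<Prod>v<n. x v ^ gt_weight g v)"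

lemma alternant_eq_det: "alternant n \<gamma> x = det (mat n n (\<lambda>(i, j). x i ^ \<gamma> j))"
proof -
  have "(\<Prod>i<n. x i ^ \<gamma> (w i)) = (\<Prod>i<n. mat n n (\<lambda>(i, j). x i ^ \<gamma> j) $$ (i, w i))"
    if "w permutes {..<n}" for w
    using permutes_in_image[OF that] by (intro prod.cong) auto
  then show ?thesis
    unfolding alternant_def det_def'[OF mat_carrier] atLeast0LessThan
    by (intro sum.cong) auto
qed

text \<open>The expansion of the transposed matrix. It is the form suited to permuting variables and
  to multilinearity in the columns, whereas the definition suits permuting exponents.\<close>

lemma alternant_eq_columns:
  "alternant n \<gamma> x = (\<Sum>w | w permutes {..<n}. of_int (sign w) * (\<Prod>j<n. x (w j) ^ \<gamma> j))"
proof -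
  have "(\<Prod>j<n. x (w j) ^ \<gamma> j) = (\<Prod>j<n. mat n n (\<lambda>(i, j). x i ^ \<gamma> j) $$ (w j, j))"
    if "w permutes {..<n}" for w
    using permutes_in_image[OF that] by (intro prod.cong) auto
  then show ?thesis
    unfolding alternant_eq_det det_col[OF mat_carrier] atLeast0LessThan
    by (intro sum.cong) auto
qed

lemma alternant_cong:
  assumes "\<And>j. j < n \<Longrightarrow> \<gamma> j = \<gamma>' j"
  shows "alternant n \<gamma> x = alternant n \<gamma>' x"
  unfolding alternant_eq_columns using assms
  by (intro sum.cong refl arg_cong2[where f = "(*)"] prod.cong) auto

text \<open>
  Subtracting \<open>x\<^sub>n\<^bsup>d j\<^esup>\<close> times column \<open>j + 1\<close> from column \<open>j\<close> clears the last row up to its last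
  entry.
\<close>

lemma alternant_Suc_eq_det:
  fixes x :: "nat \<Rightarrow> real"
  assumes d: "\<And>j. j < n \<Longrightarrow> \<gamma> j = d j + \<gamma> (Suc j)"
  shows "alternant (Suc n) \<gamma> x =
    x n ^ \<gamma> n * det (mat n n (\<lambda>(i, j). x i ^ \<gamma> j - x n ^ d j * x i ^ \<gamma> (Suc j)))"
proof -
  define M where "M = mat (Suc n) (Suc n) (\<lambda>(i, j). x i ^ \<gamma> j)"
  \<comment> \<open>\<open>U\<close> carries out all the column operations at once; it is lower
    triangular with ones on the diagonal.\<close>
  define U where "U = mat (Suc n) (Suc n)
    (\<lambda>(i, j). if i = j then 1 else if i = Suc j then - (x n ^ d j) else 0)"
  define N where "N = mat (Suc n) (Suc n)
    (\<lambda>(i, j). if j < n then x i ^ \<gamma> j - x n ^ d j * x i ^ \<gamma> (Suc j) else x i ^ \<gamma> j)"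
  have carr: "M \<in> carrier_mat (Suc n) (Suc n)" "U \<in> carrier_mat (Suc n) (Suc n)"
    "N \<in> carrier_mat (Suc n) (Suc n)" by (auto simp: M_def U_def N_def)
  have "M * U = N"
  proof (rule eq_matI)
    fix i j assume "i < dim_row N" "j < dim_col N"
    then have ij: "i < Suc n" "j < Suc n" by (auto simp: N_def)
    have "(M * U) $$ (i, j) = (\<Sum>k<Suc n. M $$ (i, k) * U $$ (k, j))"
      using ij carr by (auto simp: scalar_prod_def M_def U_def atLeast0LessThan intro!: sum.cong)
    also have "\<dots> = (\<Sum>k<Suc n. (if k = j then x i ^ \<gamma> j else 0) +
        (if k = Suc j then - (x n ^ d j) * x i ^ \<gamma> (Suc j) else 0))"
      using ij by (intro sum.cong) (auto simp: M_def U_def)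
    also have "\<dots> = N $$ (i, j)"
      using ij by (simp add: sum.distrib N_def del: sum.lessThan_Suc)
    finally show "(M * U) $$ (i, j) = N $$ (i, j)" .
  qed (auto simp: M_def U_def N_def)
  moreover have "det U = 1"
  proof -
    have "det U = prod_list (diag_mat U)"
      by (rule det_lower_triangular[OF _ carr(2)]) (auto simp: U_def)
    also have "diag_mat U = map (\<lambda>_. 1) [0..<Suc n]"
      unfolding diag_mat_def by (rule map_cong) (auto simp: U_def)
    also have "prod_list \<dots> = (1 :: real)"
      by (simp add: map_replicate_const del: upt_Suc)
    finally show ?thesis .
  qed
  ultimately have "det M = det N" using det_mult[OF carr(1,2)] by simp
  also have "\<dots> = (\<Sum>j<Suc n. N $$ (n, j) * cofactor N n j)"
    by (rule laplace_expansion_row[OF carr(3)]) simp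
  also have "\<dots> = N $$ (n, n) * cofactor N n n"
    using d by (simp add: N_def power_add)
  also have "N $$ (n, n) = x n ^ \<gamma> n" by (simp add: N_def)
  \<comment> \<open>The cofactor sign is \<open>(-1) ^ (n + n) = 1\<close>.\<close>
  also have "cofactor N n n = det (mat n n (\<lambda>(i, j). x i ^ \<gamma> j - x n ^ d j * x i ^ \<gamma> (Suc j)))"
    unfolding cofactor_def
    by (auto simp: mat_delete_def N_def power_add[symmetric] power_mult_distrib[symmetric]
        mult_2[symmetric] power_mult intro!: arg_cong[where f = det])
  finally show ?thesis by (simp add: alternant_eq_det M_def)
qed

text \<open>A geometric sum. With \<open>a = \<theta> (Suc j)\<close> and
  \<open>b = \<theta> j\<close>, the exponents \<open>k\<close> run through the values that
  interlacing allows for \<open>\<kappa> j\<close>.\<close>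

lemma power_diff_interval:
  fixes x y :: real
  assumes "a \<le> b"
  shows "x ^ Suc b - y ^ (Suc b - a) * x ^ a = (x - y) * (\<Sum>k=a..b. y ^ (b - k) * x ^ k)"
  using assms
proof (induction b rule: dec_induct)
  case base
  then show ?case by (simp add: algebra_simps)
next
  case (step b)
  have "(\<Sum>k=a..Suc b. y ^ (Suc b - k) * x ^ k)
      = y * (\<Sum>k=a..b. y ^ (b - k) * x ^ k) + x ^ Suc b"
    using step.hyps by (simp add: sum_distrib_left Suc_diff_le mult.assoc)
  then have "(x - y) * (\<Sum>k=a..Suc b. y ^ (Suc b - k) * x ^ k)
      = y * (x ^ Suc b - y ^ (Suc b - a) * x ^ a) + (x - y) * x ^ Suc b"
    unfolding step.IH by (simp add: algebra_simps)
  also have "\<dots> = x ^ Suc (Suc b) - y ^ (Suc (Suc b) - a) * x ^ a"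
    using step.hyps by (simp add: algebra_simps Suc_diff_le)
  finally show ?case ..
qed

lemma det_scale_rows:
  fixes F :: "nat \<Rightarrow> nat \<Rightarrow> real"
  shows "det (mat n n (\<lambda>(i, j). c i * F i j)) = (\<Prod>i<n. c i) * det (mat n n (\<lambda>(i, j). F i j))"
proof -
  have "(\<Prod>i<n. mat n n (\<lambda>(i, j). c i * F i j) $$ (i, w i))
      = (\<Prod>i<n. c i) * (\<Prod>i<n. mat n n (\<lambda>(i, j). F i j) $$ (i, w i))"
    if "w permutes {..<n}" for w
    unfolding prod.distrib[symmetric] using permutes_in_image[OF that] by (intro prod.cong) auto
  then show ?thesis
    unfolding det_def'[OF mat_carrier] atLeast0LessThan
    by (auto simp: sum_distrib_left intro!: sum.cong)
qed

text \<open>Multilinearity: expanding every column selects one exponent \<open>\<kappa> j\<close>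
  for each \<open>j\<close>.\<close>

lemma det_sum_columns:
  fixes x :: "nat \<Rightarrow> real"
  assumes "\<And>j. j < n \<Longrightarrow> finite (K j)"
  shows "det (mat n n (\<lambda>(i, j). \<Sum>k\<in>K j. c j k * x i ^ (k + e j)))
    = (\<Sum>\<kappa>\<in>Pi\<^sub>E {..<n} K. (\<Prod>j<n. c j (\<kappa> j)) * alternant n (\<lambda>j. \<kappa> j + e j) x)"
proof -
  have "(\<Prod>j<n. mat n n (\<lambda>(i, j). \<Sum>k\<in>K j. c j k * x i ^ (k + e j)) $$ (w j, j))
      = (\<Sum>\<kappa>\<in>Pi\<^sub>E {..<n} K. (\<Prod>j<n. c j (\<kappa> j)) * (\<Prod>j<n. x (w j) ^ (\<kappa> j + e j)))"
    if "w permutes {..<n}" for w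
  proof -
    have "(\<Prod>j<n. mat n n (\<lambda>(i, j). \<Sum>k\<in>K j. c j k * x i ^ (k + e j)) $$ (w j, j))
       = (\<Prod>j<n. \<Sum>k\<in>K j. c j k * x (w j) ^ (k + e j))"
      using permutes_in_image[OF that] by (intro prod.cong) auto
    then show ?thesis using assms by (subst (asm) prod_sum_PiE) (auto simp: prod.distrib)
  qed
  then have "det (mat n n (\<lambda>(i, j). \<Sum>k\<in>K j. c j k * x i ^ (k + e j)))
     = (\<Sum>w | w permutes {..<n}. \<Sum>\<kappa>\<in>Pi\<^sub>E {..<n} K.
         (\<Prod>j<n. c j (\<kappa> j)) * (of_int (sign w) * (\<Prod>j<n. x (w j) ^ (\<kappa> j + e j))))"
    unfolding det_col[OF mat_carrier] atLeast0LessThan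
    by (intro sum.cong) (auto simp: sum_distrib_left mult_ac)
  also have "\<dots> = (\<Sum>\<kappa>\<in>Pi\<^sub>E {..<n} K. (\<Prod>j<n. c j (\<kappa> j)) * alternant n (\<lambda>j. \<kappa> j + e j) x)"
    unfolding alternant_eq_columns sum_distrib_left by (rule sum.swap)
  finally show ?thesis .
qed

text \<open>Branching rule for alternants. After the column operations row \<open>i\<close> is
  divisible by \<open>x i - x n\<close>; the quotients are geometric sums, and multilinearity turns
  the choice of one term per column into the choice of an interlaced
  \<open>\<kappa>\<close>.\<close>

lemma alternant_Suc:
  assumes anti: "antimono \<theta>" and zero: "\<theta> (Suc n) = 0"
  shows "alternant (Suc n) (\<lambda>j. \<theta> j + staircase (Suc n) j) x =
    (\<Prod>i<n. x i - x n) * (\<Sum>\<kappa> | interlaces \<kappa> \<theta> \<and> (\<forall>r\<ge>n. \<kappa> r = 0).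
      x n ^ (\<Sum>r\<le>n. \<theta> r - \<kappa> r) * alternant n (\<lambda>j. \<kappa> j + staircase n j) x)"
proof -
  let ?\<gamma> = "\<lambda>j. \<theta> j + staircase (Suc n) j"
  let ?d = "\<lambda>j. Suc (\<theta> j) - \<theta> (Suc j)"
  let ?K = "\<lambda>j. {\<theta> (Suc j)..\<theta> j}"
  have le: "\<theta> (Suc j) \<le> \<theta> j" for j using anti by (simp add: antimono_iff_le_Suc)
  have zero': "\<theta> r = 0" if "r > n" for r using antimonoD[OF anti, of "Suc n" r] zero that by simp
  have "alternant (Suc n) ?\<gamma> x =
    x n ^ ?\<gamma> n * det (mat n n (\<lambda>(i, j). x i ^ ?\<gamma> j - x n ^ ?d j * x i ^ ?\<gamma> (Suc j)))"
  proof (rule alternant_Suc_eq_det)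
    fix j assume "j < n" then show "?\<gamma> j = ?d j + ?\<gamma> (Suc j)"
      using le[of j] by (auto simp: staircase_def)
  qed
  also have "mat n n (\<lambda>(i, j). x i ^ ?\<gamma> j - x n ^ ?d j * x i ^ ?\<gamma> (Suc j))
    = mat n n (\<lambda>(i, j). (x i - x n) *
        (\<Sum>k\<in>?K j. x n ^ (\<theta> j - k) * x i ^ (k + staircase n j)))"
  proof (rule eq_matI, clarsimp)
    fix i j assume "i < n" "j < n"
    then have s: "staircase (Suc n) j = Suc (staircase n j)" "staircase (Suc n) (Suc j) = staircase n j"
      by (auto simp: staircase_def)
    have "x i ^ ?\<gamma> j - x n ^ ?d j * x i ^ ?\<gamma> (Suc j)
        = (x i ^ Suc (\<theta> j) - x n ^ ?d j * x i ^ \<theta> (Suc j)) * x i ^ staircase n j"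
      by (simp add: s power_add algebra_simps)
    then show "x i ^ ?\<gamma> j - x n ^ ?d j * x i ^ ?\<gamma> (Suc j) = (x i - x n) *
        (\<Sum>k\<in>?K j. x n ^ (\<theta> j - k) * x i ^ (k + staircase n j))"
      unfolding power_diff_interval[OF le]
      by (simp add: sum_distrib_left sum_distrib_right power_add mult_ac)
  qed auto
  also have "det \<dots> = (\<Prod>i<n. x i - x n) * (\<Sum>\<kappa>\<in>Pi\<^sub>E {..<n} ?K.
      (\<Prod>j<n. x n ^ (\<theta> j - \<kappa> j)) * alternant n (\<lambda>j. \<kappa> j + staircase n j) x)"
    unfolding det_scale_rows by (subst det_sum_columns) auto
  also have "(\<Sum>\<kappa>\<in>Pi\<^sub>E {..<n} ?K.
      (\<Prod>j<n. x n ^ (\<theta> j - \<kappa> j)) * alternant n (\<lambda>j. \<kappa> j + staircase n j) x)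
    = (\<Sum>\<kappa> | interlaces \<kappa> \<theta> \<and> (\<forall>r\<ge>n. \<kappa> r = 0).
      (\<Prod>j<n. x n ^ (\<theta> j - \<kappa> j)) * alternant n (\<lambda>j. \<kappa> j + staircase n j) x)"
  \<comment> \<open>A choice of exponents on \<open>{..<n}\<close> is extended by zeros; the result
    interlaces because \<open>\<theta>\<close> vanishes beyond \<open>n\<close>.\<close>
  proof (rule sum.reindex_bij_witness[where j = "\<lambda>\<kappa> r. if r < n then \<kappa> r else 0"
        and i = "\<lambda>\<kappa>. restrict \<kappa> {..<n}"])
    fix \<kappa> assume \<kappa>: "\<kappa> \<in> Pi\<^sub>E {..<n} ?K"
    then show "restrict (\<lambda>r. if r < n then \<kappa> r else 0) {..<n} = \<kappa>"
      by (auto simp: fun_eq_iff restrict_def PiE_def extensional_def)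
    have "\<theta> (Suc r) \<le> \<kappa> r \<and> \<kappa> r \<le> \<theta> r" if "r < n" for r
      using PiE_mem[OF \<kappa>, of r] that by simp
    then show "(\<lambda>r. if r < n then \<kappa> r else 0) \<in> {\<kappa>. interlaces \<kappa> \<theta> \<and> (\<forall>r\<ge>n. \<kappa> r = 0)}"
      by (auto simp: interlaces_def zero')
    show "(\<Prod>j<n. x n ^ (\<theta> j - (if j < n then \<kappa> j else 0)))
        * alternant n (\<lambda>j. (if j < n then \<kappa> j else 0) + staircase n j) x
      = (\<Prod>j<n. x n ^ (\<theta> j - \<kappa> j)) * alternant n (\<lambda>j. \<kappa> j + staircase n j) x"
      by (intro arg_cong2[where f = "(*)"] prod.cong alternant_cong) auto
  next
    fix \<kappa> assume "\<kappa> \<in> {\<kappa>. interlaces \<kappa> \<theta> \<and> (\<forall>r\<ge>n. \<kappa> r = 0)}"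
    then show "(\<lambda>r. if r < n then restrict \<kappa> {..<n} r else 0) = \<kappa>" "restrict \<kappa> {..<n} \<in> Pi\<^sub>E {..<n} ?K"
      by (auto simp: fun_eq_iff interlaces_def)
  qed
  \<comment> \<open>At \<open>j = n\<close> the staircase is 0, so the outer factor is
    \<open>x n ^ \<theta> n\<close>. It supplies the summand \<open>r = n\<close> of the exponent,
    where \<open>\<kappa> n = 0\<close>.\<close>
  also have "x n ^ ?\<gamma> n * ((\<Prod>i<n. x i - x n) * (\<Sum>\<kappa> | interlaces \<kappa> \<theta> \<and> (\<forall>r\<ge>n. \<kappa> r = 0).
      (\<Prod>j<n. x n ^ (\<theta> j - \<kappa> j)) * alternant n (\<lambda>j. \<kappa> j + staircase n j) x))
    = (\<Prod>i<n. x i - x n) * (\<Sum>\<kappa> | interlaces \<kappa> \<theta> \<and> (\<forall>r\<ge>n. \<kappa> r = 0).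
      x n ^ (\<Sum>r\<le>n. \<theta> r - \<kappa> r) * alternant n (\<lambda>j. \<kappa> j + staircase n j) x)"
    unfolding sum_distrib_left lessThan_Suc_atMost[symmetric]
    by (intro sum.cong) (auto simp: power_add power_sum staircase_def mult_ac)
  finally show ?thesis .
qed

lemma schur_poly_Suc:
  "schur_poly (Suc n) \<theta> x = (\<Sum>\<kappa> | interlaces \<kappa> \<theta> \<and> (\<forall>r\<ge>n. \<kappa> r = 0).
      x n ^ (\<Sum>r\<le>n. \<theta> r - \<kappa> r) * schur_poly n \<kappa> x)"
proof -
  let ?A = "{\<kappa>. interlaces \<kappa> \<theta> \<and> (\<forall>r\<ge>n. \<kappa> r = 0)}"
  let ?f = "\<lambda>(\<kappa>, g) v. if v \<le> n then g v else \<theta>"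
  have "schur_poly (Suc n) \<theta> x = (\<Sum>(\<kappa>, g)\<in>(SIGMA \<kappa>:?A. gt_patterns n \<kappa>).
      \<Prod>v<Suc n. x v ^ gt_weight (?f (\<kappa>, g)) v)"
    unfolding schur_poly_def gt_patterns_Suc
    by (subst sum.reindex[OF inj_on_gt_patterns_Suc]) (auto intro!: sum.cong)
  also have "\<dots> = (\<Sum>(\<kappa>, g)\<in>(SIGMA \<kappa>:?A. gt_patterns n \<kappa>).
      x n ^ (\<Sum>r\<le>n. \<theta> r - \<kappa> r) * (\<Prod>v<n. x v ^ gt_weight g v))"
  proof (rule sum.cong[OF refl])
    fix z assume "z \<in> (SIGMA \<kappa>:?A. gt_patterns n \<kappa>)"
    then obtain \<kappa> g where z: "z = (\<kappa>, g)" and g: "g \<in> gt_patterns n \<kappa>" by auto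
    have "gt_weight (?f (\<kappa>, g)) v = gt_weight g v" if "v < n" for v
      using that by (simp add: weight_from_def)
    moreover have "gt_weight (?f (\<kappa>, g)) n = (\<Sum>r\<le>n. \<theta> r - \<kappa> r)"
      using g by (simp add: weight_from_def gt_patterns_def)
    ultimately show "(case z of (\<kappa>, g) \<Rightarrow> \<Prod>v<Suc n. x v ^ gt_weight (?f (\<kappa>, g)) v)
      = (case z of (\<kappa>, g) \<Rightarrow> x n ^ (\<Sum>r\<le>n. \<theta> r - \<kappa> r) * (\<Prod>v<n. x v ^ gt_weight g v))"
      by (simp add: z)
  qed
  also have "\<dots> = (\<Sum>\<kappa>\<in>?A. x n ^ (\<Sum>r\<le>n. \<theta> r - \<kappa> r) * schur_poly n \<kappa> x)"
    unfolding schur_poly_def sum_distrib_left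
    by (subst sum.Sigma) (auto intro: finite_interlaced finite_gt_patterns)
  finally show ?thesis .
qed

lemma interlaces_antimono:
  assumes "interlaces \<kappa> \<theta>"
  shows "antimono \<kappa>"
  using assms unfolding antimono_iff_le_Suc interlaces_def by (meson le_trans)

lemma alternant_staircase_Suc:
  "alternant (Suc n) (staircase (Suc n)) x = (\<Prod>i<n. x i - x n) * alternant n (staircase n) x"
proof -
  have "{\<kappa>. interlaces \<kappa> (\<lambda>_. 0) \<and> (\<forall>r\<ge>n. \<kappa> r = 0)} = {\<lambda>_. 0}"
    by (auto simp: interlaces_def)
  then show ?thesis using alternant_Suc[of "\<lambda>_. 0" n x] by (simp add: antimono_def)
qed

text \<open>Both sides obey the same recursion in the last variable: \<open>alternant_Suc\<close> on
  the left, \<open>schur_poly_Suc\<close> and \<open>alternant_staircase_Suc\<close> on the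
  right.\<close>

lemma bialternant_formula:
  assumes "antimono \<theta>" "\<theta> n = 0"
  shows "alternant n (\<lambda>j. \<theta> j + staircase n j) x = schur_poly n \<theta> x * alternant n (staircase n) x"
  using assms
proof (induction n arbitrary: \<theta>)
  case 0
  then have "\<theta> = (\<lambda>_. 0)" using antimonoD[of \<theta> 0] by (intro ext) simp
  then show ?case by (simp add: schur_poly_def gt_patterns_0 alternant_def)
next
  case (Suc n)
  have "alternant n (\<lambda>j. \<kappa> j + staircase n j) x = schur_poly n \<kappa> x * alternant n (staircase n) x"
    if "interlaces \<kappa> \<theta>" "\<forall>r\<ge>n. \<kappa> r = 0" for \<kappa>
    using Suc.IH[OF interlaces_antimono[OF that(1)]] that(2) by simp
  then show ?case
    unfolding alternant_Suc[OF Suc.prems] alternant_staircase_Suc schur_poly_Suc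
    by (simp add: sum_distrib_left sum_distrib_right mult_ac)
qed

text \<open>Permits division by the Vandermonde determinant at points with distinct
  coordinates.\<close>

lemma alternant_staircase_nonzero:
  assumes "inj_on x {..<n}"
  shows "alternant n (staircase n) x \<noteq> 0"
  using assms
proof (induction n)
  case 0
  then show ?case by (simp add: alternant_def)
next
  case (Suc n)
  then have "alternant n (staircase n) x \<noteq> 0" by (auto simp: inj_on_def)
  moreover have "x i - x n \<noteq> 0" if "i < n" for i
    using inj_onD[OF Suc.prems, of i n] that by auto
  ultimately show ?case by (simp add: alternant_staircase_Suc)
qed

section \<open>Antisymmetry of alternants and symmetry of Schur polynomials\<close>

lemma sum_sign_compose:
  fixes F :: "(nat \<Rightarrow> nat) \<Rightarrow> real"
  assumes u: "u permutes {..<n}"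
  shows "(\<Sum>w | w permutes {..<n}. of_int (sign w) * F (u \<circ> w))
    = of_int (sign u) * (\<Sum>w | w permutes {..<n}. of_int (sign w) * F w)"
  unfolding sum_distrib_left
proof (rule sum.reindex_bij_witness[where j = "\<lambda>w. u \<circ> w" and i = "\<lambda>w. Hilbert_Choice.inv u \<circ> w"])
  fix w assume "w \<in> {w. w permutes {..<n}}"
  then have w: "w permutes {..<n}" by simp
  show "Hilbert_Choice.inv u \<circ> (u \<circ> w) = w" "u \<circ> (Hilbert_Choice.inv u \<circ> w) = w"
    using permutes_inv_o[OF u] by (auto simp: o_assoc)
  show "u \<circ> w \<in> {w. w permutes {..<n}}" "Hilbert_Choice.inv u \<circ> w \<in> {w. w permutes {..<n}}"
    using u w by (auto intro: permutes_compose permutes_inv)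
  have "sign (u \<circ> w) = sign u * sign w"
    using u w by (intro sign_compose) (auto intro: permutes_imp_permutation)
  then have "sign u * sign (u \<circ> w) = sign w"
    by (simp add: mult.assoc[symmetric])
  then show "of_int (sign u) * (of_int (sign (u \<circ> w)) * F (u \<circ> w)) = of_int (sign w) * F (u \<circ> w)"
    by (simp add: mult.assoc[symmetric] flip: of_int_mult)
qed

lemma alternant_permute_variables:
  assumes "u permutes {..<n}"
  shows "alternant n \<gamma> (x \<circ> u) = of_int (sign u) * alternant n \<gamma> x"
  unfolding alternant_eq_columns
  using sum_sign_compose[OF assms, of "\<lambda>w. \<Prod>j<n. x (w j) ^ \<gamma> j"] by simp

lemma alternant_permute_exponents:
  assumes "u permutes {..<n}"
  shows "alternant n (\<gamma> \<circ> u) x = of_int (sign u) * alternant n \<gamma> x"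
  unfolding alternant_def
  using sum_sign_compose[OF assms, of "\<lambda>w. \<Prod>i<n. x i ^ \<gamma> (w i)"] by simp

lemma alternant_eq_0:
  assumes "\<not> inj_on x {..<n}"
  shows "alternant n \<gamma> x = 0"
proof -
  obtain a b where ab: "a < n" "b < n" "a \<noteq> b" "x a = x b"
    using assms by (auto simp: inj_on_def)
  have "x \<circ> transpose a b = x" using ab(4) by (auto simp: fun_eq_iff transpose_def)
  then have "alternant n \<gamma> x = - alternant n \<gamma> x"
    using alternant_permute_variables[of "transpose a b" n \<gamma> x] ab
    by (simp add: permutes_swap_id sign_swap_id)
  then show ?thesis by simp
qed

text \<open>A quotient of two antisymmetric functions is symmetric; distinct coordinates keep the
  denominator nonzero.\<close>

lemma schur_poly_symmetric:
  assumes "antimono \<theta>" "\<theta> n = 0" "u permutes {..<n}" "inj_on x {..<n}"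
  shows "schur_poly n \<theta> (x \<circ> u) = schur_poly n \<theta> x"
proof -
  have "of_int (sign u) * (schur_poly n \<theta> (x \<circ> u) * alternant n (staircase n) x)
     = of_int (sign u) * (schur_poly n \<theta> x * alternant n (staircase n) x)"
    using bialternant_formula[OF assms(1,2), of "x \<circ> u"] bialternant_formula[OF assms(1,2), of x]
    by (auto simp: alternant_permute_variables[OF assms(3)] mult_ac)
  then show ?thesis using alternant_staircase_nonzero[OF assms(4)]
    by (simp add: sign_def split: if_splits)
qed

text \<open>In the term of \<open>w\<close> the symmetric factor is rewritten with its exponents
  permuted by \<open>w\<close>, so that they add to those of the alternant. At points with repeated
  coordinates both sides vanish.\<close>

lemma alternant_mult_schur_poly:
  assumes "antimono \<rho>" "\<rho> n = 0"
  shows "alternant n \<gamma> x * schur_poly n \<rho> x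
    = (\<Sum>g\<in>gt_patterns n \<rho>. alternant n (\<lambda>j. \<gamma> j + gt_weight g j) x)"
proof (cases "inj_on x {..<n}")
  case False
  then show ?thesis by (simp add: alternant_eq_0)
next
  case True
  have "schur_poly n \<rho> x = (\<Sum>g\<in>gt_patterns n \<rho>. \<Prod>i<n. x i ^ gt_weight g (w i))"
    if w: "w permutes {..<n}" for w
  proof -
    have "schur_poly n \<rho> x = schur_poly n \<rho> (x \<circ> Hilbert_Choice.inv w)"
      using schur_poly_symmetric[OF assms permutes_inv[OF w] True] by simp
    also have "\<dots> = (\<Sum>g\<in>gt_patterns n \<rho>. \<Prod>i<n. x i ^ gt_weight g (w i))"
      unfolding schur_poly_def
    proof (rule sum.cong[OF refl])
      fix g
      show "(\<Prod>v<n. (x \<circ> Hilbert_Choice.inv w) v ^ gt_weight g v) = (\<Prod>i<n. x i ^ gt_weight g (w i))"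
       
        using prod.permute[OF w, of "\<lambda>v. (x \<circ> Hilbert_Choice.inv w) v ^ gt_weight g v"] permutes_inverses(2)[OF w]
        by simp
    qed
    finally show ?thesis .
  qed
  then have "alternant n \<gamma> x * schur_poly n \<rho> x
    = (\<Sum>w | w permutes {..<n}. \<Sum>g\<in>gt_patterns n \<rho>.
        of_int (sign w) * (\<Prod>i<n. x i ^ (\<gamma> (w i) + gt_weight g (w i))))"
    unfolding alternant_def sum_distrib_right
    by (intro sum.cong) (auto simp: sum_distrib_left power_add prod.distrib mult_ac)
  also have "\<dots> = (\<Sum>g\<in>gt_patterns n \<rho>. alternant n (\<lambda>j. \<gamma> j + gt_weight g j) x)"
    unfolding alternant_def by (rule sum.swap)
  finally show ?thesis .
qed

section \<open>Cancellation of bad patterns\<close>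

text \<open>
  Littlewood--Richardson condition in Stembridge's form: for every \<open>j\<close>, adding to \<open>\<sigma>\<close> the
  content of the columns \<open>j, j + 1, \<dots>\<close> gives a partition.
\<close>

definition lr_good :: "(nat \<Rightarrow> nat) \<Rightarrow> (nat \<Rightarrow> nat \<Rightarrow> nat) \<Rightarrow> bool" where
  "lr_good \<sigma> g \<longleftrightarrow> (\<forall>j i. \<sigma> (Suc i) + weight_from g j (Suc i) \<le> \<sigma> i + weight_from g j i)"

definition bad_column :: "(nat \<Rightarrow> nat) \<Rightarrow> (nat \<Rightarrow> nat \<Rightarrow> nat) \<Rightarrow> nat" where
  "bad_column \<sigma> g =
    (GREATEST j. \<exists>i. \<sigma> i + weight_from g j i < \<sigma> (Suc i) + weight_from g j (Suc i))"

definition bad_value :: "(nat \<Rightarrow> nat) \<Rightarrow> (nat \<Rightarrow> nat \<Rightarrow> nat) \<Rightarrow> nat" where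
  "bad_value \<sigma> g = (LEAST i. \<sigma> i + weight_from g (bad_column \<sigma> g) i
     < \<sigma> (Suc i) + weight_from g (bad_column \<sigma> g) (Suc i))"

text \<open>
  Bender--Knuth involution on the entries \<open>i\<close> and \<open>i + 1\<close> in the columns \<open>0, \<dots>, j - 1\<close>. On
  patterns it only changes row \<open>i + 1\<close>, each entry of which is reflected in the interval allowed
  by the neighbouring rows.
\<close>

definition toggle_max :: "nat \<Rightarrow> nat \<Rightarrow> (nat \<Rightarrow> nat \<Rightarrow> nat) \<Rightarrow> nat \<Rightarrow> nat" where
  "toggle_max j i g r =
    min (min (g (Suc (Suc i)) r) j) (case r of 0 \<Rightarrow> j | Suc r' \<Rightarrow> g i r')"

definition toggle_min :: "nat \<Rightarrow> (nat \<Rightarrow> nat \<Rightarrow> nat) \<Rightarrow> nat \<Rightarrow> nat" where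
  "toggle_min i g r = max (g (Suc (Suc i)) (Suc r)) (g i r)"

definition toggle :: "nat \<Rightarrow> nat \<Rightarrow> (nat \<Rightarrow> nat \<Rightarrow> nat) \<Rightarrow> nat \<Rightarrow> nat \<Rightarrow> nat" where
  "toggle j i g = g(Suc i := (\<lambda>r. if j < g (Suc i) r then g (Suc i) r
     else toggle_max j i g r + toggle_min i g r - g (Suc i) r))"

text \<open>The entry lies in its interval of reflection, so the truncated subtraction in
  \<open>toggle\<close> is exact.\<close>

lemma toggle_bounds:
  assumes g: "g \<in> gt_patterns n \<rho>" "antimono \<rho>" and le: "g (Suc i) r \<le> j"
  shows "toggle_min i g r \<le> g (Suc i) r" "g (Suc i) r \<le> toggle_max j i g r"
proof -
  note A = gt_patterns_le_Suc[OF g(1)] and B = gt_patterns_interlaces_left[OF g]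
  show "toggle_min i g r \<le> g (Suc i) r"
    using A[of i r] B[of "Suc i" r] by (simp add: toggle_min_def)
  show "g (Suc i) r \<le> toggle_max j i g r"
    using A[of "Suc i" r] B[of i] le by (cases r) (auto simp: toggle_max_def)
qed

text \<open>Only stage \<open>Suc i\<close> changes, so only its interlacing with the stages
  \<open>i\<close> and \<open>Suc (Suc i)\<close> is at stake.\<close>

lemma toggle_gt_patterns:
  assumes g: "g \<in> gt_patterns n \<rho>" "antimono \<rho>" and i: "Suc i < n"
  shows "toggle j i g \<in> gt_patterns n \<rho>"
proof -
  let ?k = "toggle j i g (Suc i)"
  note A = gt_patterns_le_Suc[OF g(1)] and B = gt_patterns_interlaces_left[OF g]
  have k: "toggle_min i g r \<le> ?k r \<and> ?k r \<le> toggle_max j i g r" if "g (Suc i) r \<le> j" for r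
    using toggle_bounds[OF g that] that by (auto simp: toggle_def)
  have k': "?k r = g (Suc i) r" if "\<not> g (Suc i) r \<le> j" for r
    using that by (simp add: toggle_def)
  have "g i r \<le> ?k r" for r
    using k[of r] k'[of r] A[of i r] by (cases "g (Suc i) r \<le> j") (auto simp: toggle_min_def)
  moreover have "?k (Suc r) \<le> g i r" for r
    using k[of "Suc r"] k'[of "Suc r"] B[of i r]
    by (cases "g (Suc i) (Suc r) \<le> j") (auto simp: toggle_max_def)
  moreover have "?k r \<le> g (Suc (Suc i)) r" for r
    using k[of r] k'[of r] A[of "Suc i" r] by (cases "g (Suc i) r \<le> j") (auto simp: toggle_max_def)
  moreover have "g (Suc (Suc i)) (Suc r) \<le> ?k r" for r
    using k[of r] k'[of r] B[of "Suc i" r] by (cases "g (Suc i) r \<le> j") (auto simp: toggle_min_def)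
  ultimately have int: "interlaces (g i) ?k" "interlaces ?k (g (Suc (Suc i)))"
    by (auto simp: interlaces_def)
  have other: "toggle j i g v = g v" if "v \<noteq> Suc i" for v using that by (simp add: toggle_def)
  have "interlaces (toggle j i g v) (toggle j i g (Suc v))" if "v < n" for v
    using int gt_patterns_interlaces[OF g(1) that] other[of v] other[of "Suc v"]
    by (cases "v = i"; cases "v = Suc i") auto
  then show ?thesis using g(1) i other by (auto simp: gt_patterns_def)
qed

text \<open>The cap at \<open>j\<close> in \<open>toggle_max\<close> keeps reflected entries at most
  \<open>j\<close>, so the columns from \<open>j\<close> on are left alone.\<close>

lemma toggle_less_iff:
  assumes "g \<in> gt_patterns n \<rho>" "antimono \<rho>"
  shows "j < toggle j i g (Suc i) r \<longleftrightarrow> j < g (Suc i) r"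
proof (cases "j < g (Suc i) r")
  case False
  then have "g (Suc i) r \<le> j" by simp
  from toggle_bounds[OF assms this] False
  have "toggle j i g (Suc i) r \<le> toggle_max j i g r" by (simp add: toggle_def)
  also have "\<dots> \<le> j" by (simp add: toggle_max_def)
  finally show ?thesis using False by simp
qed (simp add: toggle_def)

lemma toggle_toggle:
  assumes "g \<in> gt_patterns n \<rho>" "antimono \<rho>"
  shows "toggle j i (toggle j i g) = g"
proof -
  let ?g = "toggle j i g"
  \<comment> \<open>The bounds depend only on the stages \<open>i\<close> and
    \<open>Suc (Suc i)\<close>, which the toggle preserves.\<close>
  have eqs: "toggle_max j i ?g = toggle_max j i g" "toggle_min i ?g = toggle_min i g"
    by (auto simp: fun_eq_iff toggle_max_def toggle_min_def toggle_def split: nat.split)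
  have "toggle j i ?g (Suc i) r = g (Suc i) r" for r
  proof (cases "j < g (Suc i) r")
    case True
    then show ?thesis by (simp add: toggle_def)
  next
    case False
    then have le: "g (Suc i) r \<le> j" by simp
    have "toggle j i ?g (Suc i) r = toggle_max j i g r + toggle_min i g r - ?g (Suc i) r"
      unfolding toggle_def[of j i ?g] using False toggle_less_iff[OF assms, of j i r]
      by (simp add: eqs)
    then show ?thesis
      using toggle_bounds[OF assms le] False by (simp add: toggle_def)
  qed
  then show ?thesis by (auto simp: toggle_def fun_eq_iff)
qed

lemma weight_from_toggle:
  assumes "g \<in> gt_patterns n \<rho>" "antimono \<rho>" "j \<le> j'"
  shows "weight_from (toggle j i g) j' v = weight_from g j' v"
proof -
  have "toggle j i g u r - j' = g u r - j'" for u r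
  proof (cases "u = Suc i \<and> \<not> j < g (Suc i) r")
    case True
    then show ?thesis using toggle_less_iff[OF assms(1,2), of j i r] assms(3) by auto
  qed (auto simp: toggle_def)
  then show ?thesis by (simp add: weight_from_def)
qed

lemma gt_weight_toggle_other:
  assumes "v \<noteq> i" "v \<noteq> Suc i"
  shows "gt_weight (toggle j i g) v = gt_weight g v"
  using assms by (simp add: weight_from_def toggle_def)

text \<open>Up to the cap at \<open>j\<close>, \<open>toggle_min\<close> in row \<open>r\<close> and
  \<open>toggle_max\<close> in row \<open>Suc r\<close> are the maximum and the minimum of the same
  pair \<open>g (Suc (Suc i)) (Suc r)\<close>, \<open>g i r\<close>; together they contribute the
  sum of that pair.\<close>

lemma sum_toggle_bounds:
  "(\<Sum>r<N. toggle_max j i g r + min (toggle_min i g r) j) + toggle_max j i g N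
    = (\<Sum>r\<le>N. min (g (Suc (Suc i)) r) j) + (\<Sum>r<N. min (g i r) j)"
proof (induction N)
  case 0
  then show ?case by (simp add: toggle_max_def)
next
  case (Suc N)
  have "min (toggle_min i g N) j + toggle_max j i g (Suc N)
      = min (g (Suc (Suc i)) (Suc N)) j + min (g i N) j"
    by (auto simp: toggle_min_def toggle_max_def min_def max_def)
  then show ?case using Suc.IH by simp
qed

lemma sum_min_toggle:
  assumes g: "g \<in> gt_patterns n \<rho>" "antimono \<rho>" and N: "Suc (Suc i) \<le> N"
    and no_i: "\<And>r. j < g (Suc i) r \<Longrightarrow> j < g i r"
  shows "(\<Sum>r<N. min (toggle j i g (Suc i) r) j + min (g (Suc i) r) j)
    = (\<Sum>r<N. min (g (Suc (Suc i)) r) j + min (g i r) j)"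
proof -
  have "min (toggle j i g (Suc i) r) j + min (g (Suc i) r) j
      = toggle_max j i g r + min (toggle_min i g r) j" for r
  proof (cases "j < g (Suc i) r")
    \<comment> \<open>A row that is not reflected: by \<open>no_i\<close> and interlacing all
      lengths involved exceed \<open>j\<close>, and both sides equal \<open>2 * j\<close>.\<close>
    case True
    then have "j < g i r" "j < g (Suc (Suc i)) r" using no_i gt_patterns_le_Suc[OF g(1), of "Suc i" r]
      by auto
    moreover have "j < g i r'" if "r = Suc r'" for r'
      using True gt_patterns_interlaces_left[OF g, of i r'] that by simp
    ultimately show ?thesis using True
      by (auto simp: toggle_def toggle_max_def toggle_min_def split: nat.split)
  next
    case False
    then have le: "g (Suc i) r \<le> j" by simp
    have "toggle_max j i g r \<le> j" by (simp add: toggle_max_def)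
    then show ?thesis using toggle_bounds[OF g le] False by (simp add: toggle_def)
  qed
  then have "(\<Sum>r<N. min (toggle j i g (Suc i) r) j + min (g (Suc i) r) j)
    = (\<Sum>r<N. toggle_max j i g r + min (toggle_min i g r) j)" by simp
  moreover have "toggle_max j i g N = 0" "g (Suc (Suc i)) N = 0"
    using gt_patterns_eq_0[OF g(1) N] by (simp_all add: toggle_max_def)
  ultimately show ?thesis using sum_toggle_bounds[of j i g N]
    by (simp add: sum.distrib lessThan_Suc_atMost[symmetric])
qed

lemma weight_from_int:
  assumes "g \<in> gt_patterns n \<theta>" "v < N"
  shows "int (weight_from g j v) = (\<Sum>r<N. int (g (Suc v) r - j) - int (g v r - j))"
  unfolding weight_from_upto[OF assms] of_nat_sum
  by (intro sum.cong refl of_nat_diff diff_le_mono gt_patterns_le_Suc[OF assms(1)])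

text \<open>The difference counts the entries \<open>v\<close> in the first \<open>j\<close>
  columns.\<close>

lemma weight_split_int:
  assumes "g \<in> gt_patterns n \<theta>" "v < N"
  shows "int (gt_weight g v) - int (weight_from g j v) = (\<Sum>r<N. int (min (g (Suc v) r) j) - int (min (g v r) j))"
  unfolding weight_from_int[OF assms] sum_subtractf[symmetric] by (intro sum.cong) auto

text \<open>In the first \<open>j\<close> columns the toggle exchanges the numbers of entries
  \<open>i\<close> and \<open>Suc i\<close>; elsewhere nothing moves. The equations are written
  additively to avoid truncated subtraction.\<close>

lemma gt_weight_toggle:
  assumes g: "g \<in> gt_patterns n \<rho>" "antimono \<rho>" and i: "Suc i < n"
    and no_i: "\<And>r. j < g (Suc i) r \<Longrightarrow> j < g i r"
  shows "gt_weight (toggle j i g) i + weight_from g j (Suc i) = gt_weight g (Suc i) + weight_from g j i"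
    and "gt_weight (toggle j i g) (Suc i) + weight_from g j i = gt_weight g i + weight_from g j (Suc i)"
proof -
  let ?g = "toggle j i g"
  have other: "?g v = g v" if "v \<noteq> Suc i" for v using that by (simp add: toggle_def)
  note g' = toggle_gt_patterns[OF g i, of j]
  note W = weight_from_toggle[OF g order_refl[of j], of i]
  have "(\<Sum>r<Suc n. min (?g (Suc i) r) j + min (g (Suc i) r) j)
      = (\<Sum>r<Suc n. min (g (Suc (Suc i)) r) j + min (g i r) j)"
    using i by (intro sum_min_toggle[OF g]) (auto intro: no_i)
  from arg_cong[OF this, of int]
  have S: "(\<Sum>r<Suc n. int (min (?g (Suc i) r) j)) + (\<Sum>r<Suc n. int (min (g (Suc i) r) j))
      = (\<Sum>r<Suc n. int (min (g (Suc (Suc i)) r) j)) + (\<Sum>r<Suc n. int (min (g i r) j))"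
    by (simp only: of_nat_sum of_nat_add sum.distrib)
  have "int (gt_weight ?g i) - int (weight_from g j i)
      = int (gt_weight g (Suc i)) - int (weight_from g j (Suc i))"
   
    using weight_split_int[OF g', of i "Suc n" j] weight_split_int[OF g(1), of "Suc i" "Suc n" j] i S
    unfolding W sum_subtractf other[of i, simplified] by linarith
  then show "gt_weight ?g i + weight_from g j (Suc i) = gt_weight g (Suc i) + weight_from g j i"
    by linarith
  have "int (gt_weight ?g (Suc i)) - int (weight_from g j (Suc i))
      = int (gt_weight g i) - int (weight_from g j i)"
   
    using weight_split_int[OF g', of "Suc i" "Suc n" j] weight_split_int[OF g(1), of i "Suc n" j] i S
    unfolding W sum_subtractf other[of "Suc (Suc i)", simplified] by linarith
  then show "gt_weight ?g (Suc i) + weight_from g j i = gt_weight g i + weight_from g j (Suc i)"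
    by linarith
qed

text \<open>The correction counts the entries \<open>v\<close> in column \<open>j\<close>, and
  column strictness allows at most one.\<close>

lemma weight_from_Suc:
  assumes g: "g \<in> gt_patterns n \<rho>" "antimono \<rho>"
  shows "weight_from g j v = weight_from g (Suc j) v + card {r. g v r \<le> j \<and> j < g (Suc v) r}"
    and "card {r. g v r \<le> j \<and> j < g (Suc v) r} \<le> 1"
    and "finite {r. g v r \<le> j \<and> j < g (Suc v) r}"
proof -
  let ?S = "{r. g v r \<le> j \<and> j < g (Suc v) r}"
  have sub: "?S \<subseteq> {..v}"
    using gt_patterns_eq_0[OF g(1), of "Suc v"]
    by (metis (lifting) atMost_iff mem_Collect_eq not_less0 not_less_eq_eq subsetI)
  then show fin: "finite ?S" by (rule finite_subset) simp
  have "weight_from g j v = (\<Sum>r\<le>v. (g (Suc v) r - Suc j) - (g v r - Suc j) + (if r \<in> ?S then 1 else 0))"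
    unfolding weight_from_def using gt_patterns_le_Suc[OF g(1), of v]
    by (intro sum.cong) (auto simp: Suc_diff_le)
  also have "\<dots> = weight_from g (Suc j) v + card ({..v} \<inter> ?S)"
    by (simp add: sum.distrib weight_from_def sum.If_cases)
  finally show "weight_from g j v = weight_from g (Suc j) v + card ?S"
    using sub by (simp add: Int_absorb1)
  have "r = r'" if "r \<in> ?S" "r' \<in> ?S" for r r'
  proof -
    have "\<not> a < b" if "a \<in> ?S" "b \<in> ?S" for a b
    proof
      assume "a < b"
      then have "g (Suc v) b \<le> g (Suc v) (Suc a)"
        by (intro antimonoD[OF gt_patterns_antimono[OF g]]) simp
      also have "\<dots> \<le> g v a" by (rule gt_patterns_interlaces_left[OF g])
      finally show False using that by simp
    qed
    with that show ?thesis by (metis linorder_neqE_nat)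
  qed
  then show "card ?S \<le> 1" using fin by (simp add: card_le_Suc0_iff_eq)
qed

section \<open>The sign-reversing involution on bad patterns\<close>

lemma bad_column_bound:
  assumes g: "g \<in> gt_patterns n \<rho>" "antimono \<rho>" and \<sigma>: "antimono \<sigma>"
    and bad: "\<sigma> i + weight_from g j i < \<sigma> (Suc i) + weight_from g j (Suc i)"
  shows "j \<le> \<rho> 0"
proof (rule ccontr)
  assume "\<not> j \<le> \<rho> 0"
  then have "weight_from g j v = 0" for v by (intro weight_from_large[OF g]) simp
  with bad antimonoD[OF \<sigma>, of i "Suc i"] show False by simp
qed

text \<open>
  Removing one more column changes each content by at most 1, so at the last bad column the
  partition condition fails by exactly 1 and that column does not contain \<open>i\<close>.
\<close>

lemma bad_position:
  assumes g: "g \<in> gt_patterns n \<rho>" "antimono \<rho>" and \<sigma>: "antimono \<sigma>" "\<sigma> n = 0"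
    and bad: "\<not> lr_good \<sigma> g"
  defines "j \<equiv> bad_column \<sigma> g" and "i \<equiv> bad_value \<sigma> g"
  shows "Suc i < n"
    and "\<And>r. j < g (Suc i) r \<Longrightarrow> j < g i r"
    and "\<sigma> (Suc i) + weight_from g j (Suc i) = Suc (\<sigma> i + weight_from g j i)"
proof -
  let ?P = "\<lambda>j i. \<sigma> i + weight_from g j i < \<sigma> (Suc i) + weight_from g j (Suc i)"
  have bound: "j \<le> \<rho> 0" if "\<exists>i. ?P j i" for j
    using that bad_column_bound[OF g \<sigma>(1)] by blast
  from bad have ex: "\<exists>j i. ?P j i" by (auto simp: lr_good_def not_le)
  then have "\<exists>i. ?P j i"
    unfolding j_def bad_column_def using GreatestI_ex_nat[of "\<lambda>j. \<exists>i. ?P j i" "\<rho> 0"] bound by blast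
  then have P: "?P j i" unfolding i_def bad_value_def j_def by (rule LeastI_ex)
  have "\<not> ?P (Suc j) i"
  proof
    assume "?P (Suc j) i"
    then have "Suc j \<le> j"
      unfolding j_def bad_column_def using bound by (intro Greatest_le_nat[where b = "\<rho> 0"]) blast+
    then show False by simp
  qed
  with P weight_from_Suc(1,2)[OF g, where j = j and v = i]
    weight_from_Suc(1,2)[OF g, where j = j and v = "Suc i"]
  have eq: "\<sigma> (Suc i) + weight_from g j (Suc i) = Suc (\<sigma> i + weight_from g j i)"
    and "card {r. g i r \<le> j \<and> j < g (Suc i) r} = 0" by auto
  then show "\<And>r. j < g (Suc i) r \<Longrightarrow> j < g i r"
    and "\<sigma> (Suc i) + weight_from g j (Suc i) = Suc (\<sigma> i + weight_from g j i)"
    using weight_from_Suc(3)[OF g, of i j] by (auto simp: not_le)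
  show "Suc i < n"
  proof (rule ccontr)
    assume "\<not> Suc i < n"
    with weight_from_eq_0[OF g(1), of "Suc i"] antimonoD[OF \<sigma>(1), of n "Suc i"] \<sigma>(2) P
    show False by simp
  qed
qed

text \<open>The conditions at the columns from the bad one on are untouched, so neither the last bad
  column nor the least bad value there moves. Hence toggling at the bad position is an
  involution.\<close>

lemma bad_position_toggle:
  fixes \<sigma> :: "nat \<Rightarrow> nat"
  assumes g: "g \<in> gt_patterns n \<rho>" "antimono \<rho>" and \<sigma>: "antimono \<sigma>" "\<sigma> n = 0"
    and bad: "\<not> lr_good \<sigma> g"
  defines "g' \<equiv> toggle (bad_column \<sigma> g) (bad_value \<sigma> g) g"
  shows "bad_column \<sigma> g' = bad_column \<sigma> g" "bad_value \<sigma> g' = bad_value \<sigma> g" "\<not> lr_good \<sigma> g'"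
proof -
  let ?P = "\<lambda>g j i. \<sigma> i + weight_from g j i < \<sigma> (Suc i) + weight_from g j (Suc i)"
  let ?j = "bad_column \<sigma> g"
  note pos = bad_position[OF g \<sigma> bad]
  have eq: "weight_from g' j v = weight_from g j v" if "?j \<le> j" for j v
    unfolding g'_def by (rule weight_from_toggle[OF g that])
  have g': "g' \<in> gt_patterns n \<rho>" unfolding g'_def by (rule toggle_gt_patterns[OF g pos(1)])
  have P: "?P g ?j (bad_value \<sigma> g)" using pos(3) by simp
  with eq have P': "?P g' ?j (bad_value \<sigma> g)" by simp
  then show "\<not> lr_good \<sigma> g'" by (auto simp: lr_good_def not_le)
  have bound: "j \<le> \<rho> 0" if "\<exists>i. ?P h j i" "h \<in> gt_patterns n \<rho>" for h j
    using that(1) bad_column_bound[OF that(2) g(2) \<sigma>(1)] by blast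
  show col: "bad_column \<sigma> g' = ?j"
    unfolding bad_column_def[of \<sigma> g']
  proof (rule Greatest_equality)
    show "\<exists>i. ?P g' ?j i" using P' by blast
    fix j assume j: "\<exists>i. ?P g' j i"
    show "j \<le> ?j"
    proof (rule ccontr)
      assume "\<not> j \<le> ?j"
      with j eq have "\<exists>i. ?P g j i" by simp
      then have "j \<le> ?j" unfolding bad_column_def
        using bound[OF _ g(1)] by (intro Greatest_le_nat[where b = "\<rho> 0"]) blast+
      with \<open>\<not> j \<le> ?j\<close> show False by simp
    qed
  qed
  show "bad_value \<sigma> g' = bad_value \<sigma> g"
    unfolding bad_value_def col using eq by simp
qed

text \<open>The violation by exactly 1 compensates the step of \<open>staircase\<close> between
  \<open>i\<close> and \<open>Suc i\<close>. The toggle therefore transposes two complete exponents,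
  which reverses the sign of the alternant.\<close>

lemma alternant_toggle:
  assumes g: "g \<in> gt_patterns n \<rho>" "antimono \<rho>" and \<sigma>: "antimono \<sigma>" "\<sigma> n = 0"
    and bad: "\<not> lr_good \<sigma> g"
  shows "alternant n (\<lambda>v. \<sigma> v + staircase n v +
       gt_weight (toggle (bad_column \<sigma> g) (bad_value \<sigma> g) g) v) x
    = - alternant n (\<lambda>v. \<sigma> v + staircase n v + gt_weight g v) x"
proof -
  let ?i = "bad_value \<sigma> g" and ?j = "bad_column \<sigma> g"
  let ?\<gamma> = "\<lambda>v. \<sigma> v + staircase n v + gt_weight g v"
  note pos = bad_position[OF g \<sigma> bad]
  note wt = gt_weight_toggle[OF g pos(1) pos(2)]
  have st: "staircase n ?i = Suc (staircase n (Suc ?i))"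
    using pos(1) by (simp add: staircase_def)
  have "(\<lambda>v. \<sigma> v + staircase n v + gt_weight (toggle ?j ?i g) v) v
      = (?\<gamma> \<circ> transpose ?i (Suc ?i)) v" for v
  proof (cases "v = ?i \<or> v = Suc ?i")
    case True
    then show ?thesis using wt pos(3) st by auto
  next
    case False
    then show ?thesis by (simp add: gt_weight_toggle_other transpose_def)
  qed
  then have "(\<lambda>v. \<sigma> v + staircase n v + gt_weight (toggle ?j ?i g) v) = ?\<gamma> \<circ> transpose ?i (Suc ?i)"
    by (rule ext)
  moreover have "transpose ?i (Suc ?i) permutes {..<n}"
    using pos(1) by (intro permutes_swap_id) auto
  ultimately show ?thesis by (simp add: alternant_permute_exponents sign_swap_id)
qed

lemma alternant_littlewood_richardson:
  assumes \<rho>: "antimono \<rho>" "\<rho> n = 0" and \<sigma>: "antimono \<sigma>" "\<sigma> n = 0"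
  shows "alternant n (\<lambda>v. \<sigma> v + staircase n v) x * schur_poly n \<rho> x
    = (\<Sum>g\<in>{g \<in> gt_patterns n \<rho>. lr_good \<sigma> g}.
        alternant n (\<lambda>v. \<sigma> v + gt_weight g v + staircase n v) x)"
proof -
  let ?f = "\<lambda>g. alternant n (\<lambda>v. \<sigma> v + staircase n v + gt_weight g v) x"
  let ?B = "{g \<in> gt_patterns n \<rho>. \<not> lr_good \<sigma> g}"
  let ?t = "\<lambda>g. toggle (bad_column \<sigma> g) (bad_value \<sigma> g) g"
  have tB: "?t g \<in> ?B" if "g \<in> ?B" for g
    using that toggle_gt_patterns[OF _ \<rho>(1)] bad_position(1)[OF _ \<rho>(1) \<sigma>]
      bad_position_toggle(3)[OF _ \<rho>(1) \<sigma>] by auto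
  have tt: "?t (?t g) = g" if "g \<in> ?B" for g
    using that bad_position_toggle(1,2)[OF _ \<rho>(1) \<sigma>] toggle_toggle[OF _ \<rho>(1)] by auto
  \<comment> \<open>Reindexing by the involution \<open>?t\<close> shows that the bad sum equals its
    own negative.\<close>
  have "sum ?f ?B = (\<Sum>g\<in>?B. - ?f g)"
    using tB tt alternant_toggle[OF _ \<rho>(1) \<sigma>, of _ x]
    by (intro sum.reindex_bij_witness[of _ ?t ?t]) auto
  then have zero: "sum ?f ?B = 0" by (simp add: sum_negf)
  have "alternant n (\<lambda>v. \<sigma> v + staircase n v) x * schur_poly n \<rho> x = sum ?f (gt_patterns n \<rho>)"
    by (rule alternant_mult_schur_poly[OF \<rho>])
  also have "gt_patterns n \<rho> = {g \<in> gt_patterns n \<rho>. lr_good \<sigma> g} \<union> ?B" by auto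
  also have "sum ?f \<dots> = sum ?f {g \<in> gt_patterns n \<rho>. lr_good \<sigma> g} + sum ?f ?B"
    using finite_gt_patterns by (intro sum.union_disjoint) auto
  finally show ?thesis using zero by (simp add: add_ac)
qed

section \<open>Linear independence of monomials\<close>

text \<open>Reduction modulo \<open>B\<close> recovers the digit of index 0, and division by
  \<open>B\<close> shifts the remaining ones.\<close>

lemma base_expansion_unique:
  fixes f h :: "nat \<Rightarrow> nat"
  assumes "\<And>v. v < n \<Longrightarrow> f v < B" "\<And>v. v < n \<Longrightarrow> h v < B"
    and "(\<Sum>v<n. f v * B ^ v) = (\<Sum>v<n. h v * B ^ v)"
  shows "\<forall>v<n. f v = h v"
  using assms
proof (induction n arbitrary: f h)
  case 0
  then show ?case by simp
next
  case (Suc n)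
  have split: "(\<Sum>v<Suc n. p v * B ^ v) = p 0 + B * (\<Sum>v<n. p (Suc v) * B ^ v)" for p :: "nat \<Rightarrow> nat"
    by (subst sum.lessThan_Suc_shift) (simp add: sum_distrib_left mult_ac)
  have eq: "f 0 + B * (\<Sum>v<n. f (Suc v) * B ^ v) = h 0 + B * (\<Sum>v<n. h (Suc v) * B ^ v)"
    using Suc.prems(3) unfolding split .
  have lt: "f 0 < B" "h 0 < B" using Suc.prems by auto
  have "f 0 = h 0" using arg_cong[OF eq, of "\<lambda>z. z mod B"] lt by simp
  with eq lt have "(\<Sum>v<n. f (Suc v) * B ^ v) = (\<Sum>v<n. h (Suc v) * B ^ v)" by auto
  with Suc.prems have "\<forall>v<n. f (Suc v) = h (Suc v)" by (intro Suc.IH) auto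
  with \<open>f 0 = h 0\<close> show ?case by (auto simp: less_Suc_eq_0_disj)
qed

text \<open>
  Evaluation at \<open>x\<^sub>v = t ^ B\<^sup>v\<close> for large \<open>B\<close> turns distinct monomials into distinct powers of
  \<open>t\<close>.
\<close>

lemma monomial_functions_independent:
  fixes e :: "'i \<Rightarrow> real" and d :: "'j \<Rightarrow> real" and n :: nat
    and p :: "'i \<Rightarrow> nat \<Rightarrow> nat" and q :: "'j \<Rightarrow> nat \<Rightarrow> nat"
  assumes fin: "finite I" "finite J"
    and supp: "\<And>i v. i \<in> I \<Longrightarrow> n \<le> v \<Longrightarrow> p i v = 0" "\<And>j v. j \<in> J \<Longrightarrow> n \<le> v \<Longrightarrow> q j v = 0"
    and eq: "\<And>x. inj_on x {..<n} \<Longrightarrow>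
      (\<Sum>i\<in>I. e i * (\<Prod>v<n. x v ^ p i v)) = (\<Sum>j\<in>J. d j * (\<Prod>v<n. x v ^ q j v))"
  shows "(\<Sum>i\<in>{i \<in> I. p i = m}. e i) = (\<Sum>j\<in>{j \<in> J. q j = m}. d j)"
proof -
  \<comment> \<open>\<open>B\<close> exceeds every exponent that occurs. The summand 2 makes the
    powers \<open>B ^ v\<close> distinct, so the evaluation points have distinct coordinates, as
    \<open>eq\<close> demands.\<close>
  define B where "B = 2 + (\<Sum>i\<in>I. \<Sum>v<n. p i v) + (\<Sum>j\<in>J. \<Sum>v<n. q j v)"
  define N where "N f = (\<Sum>v<n. f v * B ^ v)" for f :: "nat \<Rightarrow> nat"
  have pB: "p i v < B" if "i \<in> I" "v < n" for i v
  proof -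
    have "p i v \<le> (\<Sum>v<n. p i v)" using that by (intro member_le_sum) auto
    also have "\<dots> \<le> (\<Sum>i\<in>I. \<Sum>v<n. p i v)"
      using that fin by (intro member_le_sum[where f = "\<lambda>i. \<Sum>v<n. p i v"]) auto
    finally show ?thesis by (simp add: B_def)
  qed
  have qB: "q j v < B" if "j \<in> J" "v < n" for j v
  proof -
    have "q j v \<le> (\<Sum>v<n. q j v)" using that by (intro member_le_sum) auto
    also have "\<dots> \<le> (\<Sum>j\<in>J. \<Sum>v<n. q j v)"
      using that fin by (intro member_le_sum[where f = "\<lambda>j. \<Sum>v<n. q j v"]) auto
    finally show ?thesis by (simp add: B_def)
  qed
  define P where "P = (\<Sum>i\<in>I. monom (e i) (N (p i)))"
  define Q where "Q = (\<Sum>j\<in>J. monom (d j) (N (q j)))"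
  have "poly P t = poly Q t" if "t > 1" for t
  proof -
    have mon: "(\<Prod>v<n. (t ^ (B ^ v)) ^ f v) = t ^ N f" for f
      by (simp add: N_def power_sum power_mult[symmetric] mult.commute)
    have "inj_on (\<lambda>v. t ^ (B ^ v)) {..<n}"
      using that by (intro inj_onI) (simp add: B_def power_inject_exp)
    from eq[OF this] show ?thesis by (simp add: P_def Q_def poly_sum poly_monom mon)
  qed
  then have "{1<..} \<subseteq> {t. poly (P - Q) t = 0}" by auto
  then have "infinite {t. poly (P - Q) t = 0}"
    using infinite_Ioi[of "1 :: real"] finite_subset by blast
  then have PQ: "P = Q" using poly_roots_finite[of "P - Q"] by auto
  show ?thesis
  proof (cases "(\<forall>v<n. m v < B) \<and> (\<forall>v\<ge>n. m v = 0)")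
    case True
    have code: "N f = N m \<longleftrightarrow> f = m" if "\<And>v. v < n \<Longrightarrow> f v < B" "\<And>v. n \<le> v \<Longrightarrow> f v = 0" for f
    proof
      assume "N f = N m"
      with True that have "\<forall>v<n. f v = m v" unfolding N_def by (intro base_expansion_unique) auto
      with True that show "f = m" by (metis not_le ext)
    qed simp
    have "coeff P (N m) = (\<Sum>i\<in>I. if p i = m then e i else 0)"
      unfolding P_def coeff_sum using code pB supp(1) by (intro sum.cong) auto
    moreover have "coeff Q (N m) = (\<Sum>j\<in>J. if q j = m then d j else 0)"
      unfolding Q_def coeff_sum using code qB supp(2) by (intro sum.cong) auto
    ultimately show ?thesis using PQ fin by (simp add: sum.inter_filter)
  next
    \<comment> \<open>No exponent vector of either family can equal \<open>m\<close>, so both sums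
      are empty.\<close>
    case False
    then have "{i \<in> I. p i = m} = {}" "{j \<in> J. q j = m} = {}"
      using pB qB supp by auto
    then show ?thesis by (simp only: sum.empty)
  qed
qed

section \<open>The Littlewood--Richardson rule\<close>

text \<open>No alphabet is fixed; by \<open>lr_patterns_stable\<close> the Littlewood--Richardson
  condition bounds the entries by itself.\<close>

definition lr_patterns :: "(nat \<Rightarrow> nat) \<Rightarrow> (nat \<Rightarrow> nat) \<Rightarrow> (nat \<Rightarrow> nat \<Rightarrow> nat) set" where
  "lr_patterns \<sigma> \<rho> = {g. (\<exists>n. g \<in> gt_patterns n \<rho>) \<and> lr_good \<sigma> g}"

lemma gt_weight_support:
  assumes "g \<in> gt_patterns n \<theta>"
  shows "{v. gt_weight g v \<noteq> 0} \<subseteq> {..<n}"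
proof
  fix v assume "v \<in> {v. gt_weight g v \<noteq> 0}"
  then show "v \<in> {..<n}" using weight_from_eq_0[OF assms, of v 0] by (cases "v < n") auto
qed

lemma gt_patterns_subset:
  assumes "antimono \<rho>" "k \<le> n"
  shows "gt_patterns k \<rho> \<subseteq> gt_patterns n \<rho>"
proof
  fix g assume g: "g \<in> gt_patterns k \<rho>"
  have "interlaces (g v) (g (Suc v))" for v
    using gt_patterns_le_Suc[OF g] gt_patterns_interlaces_left[OF g assms(1)]
    by (auto simp: interlaces_def)
  then show "g \<in> gt_patterns n \<rho>" using g assms(2) by (auto simp: gt_patterns_def)
qed

text \<open>The left side telescopes to the size of stage \<open>V\<close>, which has at most
  \<open>V\<close> rows and lies inside \<open>\<rho>\<close>.\<close>

lemma sum_gt_weight_le: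
  assumes g: "g \<in> gt_patterns n \<rho>"
  shows "(\<Sum>v<V. gt_weight g v) \<le> (\<Sum>r<V. \<rho> r)"
proof -
  have "int (\<Sum>v<V. gt_weight g v) = (\<Sum>v<V. \<Sum>r<V. int (g (Suc v) r) - int (g v r))"
    unfolding of_nat_sum by (intro sum.cong) (auto simp: weight_from_int[OF g, of _ V])
  also have "\<dots> = (\<Sum>r<V. \<Sum>v<V. int (g (Suc v) r) - int (g v r))" by (rule sum.swap)
  also have "\<dots> = (\<Sum>r<V. int (g V r))"
  proof (intro sum.cong refl)
    fix r
    show "(\<Sum>v<V. int (g (Suc v) r) - int (g v r)) = int (g V r)"
      using g sum_lessThan_telescope[of "\<lambda>v. int (g v r)" V] by (simp add: gt_patterns_def)
  qed
  also have "\<dots> \<le> (\<Sum>r<V. int (\<rho> r))"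
    using gt_patterns_le_shape[OF g] by (intro sum_mono) simp
  also have "\<dots> = int (\<Sum>r<V. \<rho> r)" by simp
  finally show ?thesis by linarith
qed

lemma sum_partition_le:
  assumes "is_partition \<mu>"
  shows "(\<Sum>v<V. \<mu> v) \<le> (\<Sum>v<num_parts \<mu>. \<mu> v)"
proof -
  have "(\<Sum>v<V. \<mu> v) = (\<Sum>v\<in>{..<V} \<inter> {..<num_parts \<mu>}. \<mu> v)"
    using partition_nonzero_iff[OF assms] by (intro sum.mono_neutral_right) auto
  also have "\<dots> \<le> (\<Sum>v<num_parts \<mu>. \<mu> v)" by (intro sum_mono2) auto
  finally show ?thesis .
qed

lemma lr_good_antimono:
  assumes "lr_good \<sigma> g"
  shows "antimono (\<lambda>v. \<sigma> v + gt_weight g v)"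
  using assms by (auto simp: lr_good_def antimono_iff_le_Suc)

text \<open>\<open>\<sigma>\<close> plus the full content is a partition. If \<open>v\<close> occurs
  as an entry, the parts \<open>0, ..., v\<close> of this partition are all positive, so
  \<open>v\<close> is less than the total size of \<open>\<sigma>\<close> and \<open>\<rho>\<close>.
  The pattern is thus constant from stage \<open>n\<close> on.\<close>

lemma lr_patterns_stable:
  assumes \<sigma>: "is_partition \<sigma>" and \<rho>: "is_partition \<rho>"
    and n: "(\<Sum>v<num_parts \<sigma>. \<sigma> v) + (\<Sum>v<num_parts \<rho>. \<rho> v) \<le> n"
  shows "lr_patterns \<sigma> \<rho> = {g \<in> gt_patterns n \<rho>. lr_good \<sigma> g}"
proof -
  have anti: "antimono \<rho>" using \<rho> by (simp add: is_partition_def)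
  have "g \<in> gt_patterns n \<rho>" if g: "g \<in> gt_patterns k \<rho>" and good: "lr_good \<sigma> g" for g k
  proof (cases "k \<le> n")
    case True
    with g gt_patterns_subset[OF anti] show ?thesis by blast
  next
    case False
    have weight0: "gt_weight g v = 0" if v: "n \<le> v" for v
    proof (rule ccontr)
      assume nz: "gt_weight g v \<noteq> 0"
      have "1 \<le> \<sigma> u + gt_weight g u" if "u \<le> v" for u
        using antimonoD[OF lr_good_antimono[OF good] that] nz by simp
      then have "(\<Sum>u<Suc v. 1) \<le> (\<Sum>u<Suc v. \<sigma> u + gt_weight g u)" by (intro sum_mono) simp
      also have "\<dots> = (\<Sum>u<Suc v. \<sigma> u) + (\<Sum>u<Suc v. gt_weight g u)" by (rule sum.distrib)
      also have "\<dots> \<le> n"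
        using sum_partition_le[OF \<sigma>, of "Suc v"] sum_partition_le[OF \<rho>, of "Suc v"]
          sum_gt_weight_le[OF g, of "Suc v"] n by linarith
      finally show False using v by simp
    qed
    have step: "g (Suc v) = g v" if "n \<le> v" for v
    proof
      fix r
      show "g (Suc v) r = g v r"
      proof (cases "r \<le> v")
        case True
        then have "g (Suc v) r - g v r = 0"
          using weight0[OF that] by (simp add: weight_from_def)
        then show ?thesis using gt_patterns_le_Suc[OF g, of v r] by simp
      next
        case False
        then show ?thesis using gt_patterns_eq_0[OF g, of v r] gt_patterns_eq_0[OF g, of "Suc v" r]
          by simp
      qed
    qed
    have const: "g v = g n" if "n \<le> v" for v
      using that by (induction v rule: dec_induct) (auto simp: step)
    have "g k = \<rho>" using g by (simp add: gt_patterns_def)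
    then have "g n = \<rho>" using const[of k] False by simp
    then have "\<forall>v\<ge>n. g v = \<rho>" using const by metis
    then show ?thesis using g False by (simp add: gt_patterns_def)
  qed
  then show ?thesis by (auto simp: lr_patterns_def)
qed

lemma finite_lr_patterns:
  assumes "is_partition \<sigma>" "is_partition \<rho>"
  shows "finite (lr_patterns \<sigma> \<rho>)"
  using lr_patterns_stable[OF assms order_refl] finite_gt_patterns by simp

lemma is_partition_lr:
  assumes \<sigma>: "is_partition \<sigma>" and g: "g \<in> lr_patterns \<sigma> \<rho>"
  shows "is_partition (\<lambda>v. \<sigma> v + gt_weight g v)"
proof -
  obtain n where n: "g \<in> gt_patterns n \<rho>" using g by (auto simp: lr_patterns_def)
  have "{v. \<sigma> v + gt_weight g v \<noteq> 0} \<subseteq> {v. \<sigma> v \<noteq> 0} \<union> {..<n}"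
    using gt_weight_support[OF n] by auto
  then have "finite {v. \<sigma> v + gt_weight g v \<noteq> 0}"
    by (rule finite_subset) (use \<sigma> in \<open>simp add: is_partition_def\<close>)
  then show ?thesis
    using g by (auto simp: is_partition_def lr_patterns_def intro: lr_good_antimono)
qed

text \<open>A pair of patterns determines the splitting of \<open>m\<close> through its two weights,
  so the Cauchy product counts a disjoint union.\<close>

lemma schur_mult_coefficient:
  assumes \<sigma>: "is_partition \<sigma>" and \<rho>: "is_partition \<rho>" and m: "Poly_Mapping.keys m \<subseteq> {..<n}"
  shows "(schur \<sigma> \<odot> schur \<rho>) m = int (card {(g, h) \<in> gt_patterns n \<sigma> \<times> gt_patterns n \<rho>.
    (\<lambda>v. gt_weight g v + gt_weight h v) = Poly_Mapping.lookup m})"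
proof -
  let ?X = "\<lambda>\<theta> a. {g \<in> gt_patterns n \<theta>. gt_weight g = Poly_Mapping.lookup a}"
  let ?S = "{(a, b). a + b = m}"
  have keys: "Poly_Mapping.keys a \<subseteq> {..<n}" "Poly_Mapping.keys b \<subseteq> {..<n}" if "a + b = m" for a b
    using m unfolding that[symmetric] by (auto simp: in_keys_iff lookup_add subset_iff)
  have "(schur \<sigma> \<odot> schur \<rho>) m = int (\<Sum>(a, b)\<in>?S. card (?X \<sigma> a \<times> ?X \<rho> b))"
    unfolding series_mult_def of_nat_sum
    using schur_eq_card_gt_patterns[OF \<sigma> keys(1)] schur_eq_card_gt_patterns[OF \<rho> keys(2)]
    by (intro sum.cong) (auto simp: card_cartesian_product)
  also have "(\<Sum>(a, b)\<in>?S. card (?X \<sigma> a \<times> ?X \<rho> b)) = card (\<Union>(a, b)\<in>?S. ?X \<sigma> a \<times> ?X \<rho> b)"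
    using finite_monomial_splittings[of m] finite_gt_patterns
    by (subst card_UN_disjoint) (auto simp: lookup_inject intro!: sum.cong)
  also have "(\<Union>(a, b)\<in>?S. ?X \<sigma> a \<times> ?X \<rho> b) = {(g, h) \<in> gt_patterns n \<sigma> \<times> gt_patterns n \<rho>.
    (\<lambda>v. gt_weight g v + gt_weight h v) = Poly_Mapping.lookup m}" (is "?L = ?R")
  proof (intro Set.set_eqI iffI)
    fix z assume "z \<in> ?L"
    then show "z \<in> ?R" by (auto simp: lookup_add fun_eq_iff)
  next
    fix z assume "z \<in> ?R"
    then obtain g h where z: "z = (g, h)" "g \<in> gt_patterns n \<sigma>" "h \<in> gt_patterns n \<rho>"
      and sum: "\<And>v. gt_weight g v + gt_weight h v = Poly_Mapping.lookup m v"
      by (auto simp: fun_eq_iff)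
    have "\<exists>a. Poly_Mapping.lookup a = gt_weight g" if "g \<in> gt_patterns n \<theta>" for g \<theta>
    proof -
      have "finite {v. gt_weight g v \<noteq> 0}"
        by (rule finite_subset[OF gt_weight_support[OF that]]) simp
      then show ?thesis
        by (intro exI[of _ "Abs_poly_mapping (gt_weight g)"]) (simp add: Abs_poly_mapping_inverse)
    qed
    then obtain a b where ab: "Poly_Mapping.lookup a = gt_weight g" "Poly_Mapping.lookup b = gt_weight h"
      using z by metis
    then have "a + b = m" using sum by (intro poly_mapping_eqI) (simp add: lookup_add)
    then have "(a, b) \<in> ?S" by simp
    with ab z show "z \<in> ?L" by (intro UN_I[of "(a, b)"]) auto
  qed
  finally show ?thesis .
qed

text \<open>The Littlewood--Richardson rule: the alternant identity is divided by the Vandermonde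
  determinant, and then the coefficients of \<open>m\<close> in \<open>n\<close> variables are
  compared.\<close>

lemma schur_mult_eq_sum:
  assumes \<sigma>: "is_partition \<sigma>" and \<rho>: "is_partition \<rho>"
  shows "(schur \<sigma> \<odot> schur \<rho>) m = (\<Sum>g\<in>lr_patterns \<sigma> \<rho>. schur (\<lambda>v. \<sigma> v + gt_weight g v) m)"
proof -
  let ?\<theta> = "\<lambda>g v. \<sigma> v + gt_weight g v"
  \<comment> \<open>Large enough for \<open>lr_patterns_stable\<close>, for the parts of both
    partitions and for all variables in \<open>m\<close>.\<close>
  define n where "n = (\<Sum>v<num_parts \<sigma>. \<sigma> v) + (\<Sum>v<num_parts \<rho>. \<rho> v)
    + num_parts \<sigma> + num_parts \<rho> + Suc (\<Sum>v\<in>Poly_Mapping.keys m. v)"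
  have "v < n" if "v \<in> Poly_Mapping.keys m" for v
    using member_le_sum[OF that, of "\<lambda>v. v"] by (simp add: n_def)
  then have keys: "Poly_Mapping.keys m \<subseteq> {..<n}" by auto
  have lr: "lr_patterns \<sigma> \<rho> = {g \<in> gt_patterns n \<rho>. lr_good \<sigma> g}"
    using lr_patterns_stable[OF \<sigma> \<rho>, of n] by (simp add: n_def)
  have zero: "\<sigma> n = 0" "\<rho> n = 0"
    using partition_eq_0[OF \<sigma>, of n] partition_eq_0[OF \<rho>, of n] by (auto simp: n_def)
  have anti: "antimono \<sigma>" "antimono \<rho>" using \<sigma> \<rho> by (auto simp: is_partition_def)
  have \<theta>: "is_partition (?\<theta> g)" "antimono (?\<theta> g)" "?\<theta> g n = 0" if "g \<in> lr_patterns \<sigma> \<rho>" for g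
    using is_partition_lr[OF \<sigma> that] that zero weight_from_eq_0[of g n \<rho> n 0]
    by (auto simp: is_partition_def lr)
  have prod: "schur_poly n \<sigma> x * schur_poly n \<rho> x = (\<Sum>g\<in>lr_patterns \<sigma> \<rho>. schur_poly n (?\<theta> g) x)"
    if x: "inj_on x {..<n}" for x
  proof -
    have "alternant n (staircase n) x * (schur_poly n \<sigma> x * schur_poly n \<rho> x)
        = alternant n (\<lambda>v. \<sigma> v + staircase n v) x * schur_poly n \<rho> x"
      by (simp add: bialternant_formula[OF anti(1) zero(1)])
    also have "\<dots> = (\<Sum>g\<in>lr_patterns \<sigma> \<rho>. alternant n (\<lambda>v. ?\<theta> g v + staircase n v) x)"
      unfolding lr by (rule alternant_littlewood_richardson[OF anti(2) zero(2) anti(1) zero(1)])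
    also have "\<dots> = alternant n (staircase n) x * (\<Sum>g\<in>lr_patterns \<sigma> \<rho>. schur_poly n (?\<theta> g) x)"
      unfolding sum_distrib_left using bialternant_formula \<theta>(2,3)
      by (intro sum.cong) (auto simp: mult.commute)
    finally show ?thesis using alternant_staircase_nonzero[OF x] by simp
  qed
  \<comment> \<open>\<open>?I\<close> and \<open>?J\<close> index the monomials of the product and
    of the sum of Schur polynomials.\<close>
  let ?I = "gt_patterns n \<sigma> \<times> gt_patterns n \<rho>"
  let ?J = "SIGMA g:lr_patterns \<sigma> \<rho>. gt_patterns n (?\<theta> g)"
  let ?p = "\<lambda>z v. gt_weight (fst z) v + gt_weight (snd z) v"
  let ?q = "\<lambda>z. gt_weight (snd z)"
  have "(\<Sum>z\<in>{z \<in> ?I. ?p z = Poly_Mapping.lookup m}. 1 :: real)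
      = (\<Sum>z\<in>{z \<in> ?J. ?q z = Poly_Mapping.lookup m}. 1)"
  proof (rule monomial_functions_independent[where n = n])
    show "finite ?I" using finite_gt_patterns by simp
    show "finite ?J" using finite_gt_patterns finite_lr_patterns[OF \<sigma> \<rho>] by simp
    show "?p z v = 0" if "z \<in> ?I" "n \<le> v" for z v
      using that weight_from_eq_0 by auto
    show "?q z v = 0" if "z \<in> ?J" "n \<le> v" for z v
      using that weight_from_eq_0 by auto
    show "(\<Sum>z\<in>?I. 1 * (\<Prod>v<n. x v ^ ?p z v)) = (\<Sum>z\<in>?J. 1 * (\<Prod>v<n. x v ^ ?q z v))"
      if "inj_on x {..<n}" for x :: "nat \<Rightarrow> real"
    proof -
      have "(\<Sum>z\<in>?I. 1 * (\<Prod>v<n. x v ^ ?p z v)) = schur_poly n \<sigma> x * schur_poly n \<rho> x"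
        unfolding schur_poly_def sum_product sum.cartesian_product
        by (intro sum.cong) (auto simp: power_add prod.distrib)
      also have "\<dots> = (\<Sum>z\<in>?J. 1 * (\<Prod>v<n. x v ^ ?q z v))"
        unfolding prod[OF that] unfolding schur_poly_def
        using finite_gt_patterns finite_lr_patterns[OF \<sigma> \<rho>]
        by (subst sum.Sigma) (auto intro!: sum.cong)
      finally show ?thesis .
    qed
  qed
  then have card: "card {z \<in> ?I. ?p z = Poly_Mapping.lookup m} = card {z \<in> ?J. ?q z = Poly_Mapping.lookup m}"
    by simp
  have "{z \<in> ?J. ?q z = Poly_Mapping.lookup m} = (SIGMA g:lr_patterns \<sigma> \<rho>.
      {h \<in> gt_patterns n (?\<theta> g). gt_weight h = Poly_Mapping.lookup m})" by auto
  then have "int (card {z \<in> ?J. ?q z = Poly_Mapping.lookup m})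
    = (\<Sum>g\<in>lr_patterns \<sigma> \<rho>. int (card {h \<in> gt_patterns n (?\<theta> g). gt_weight h = Poly_Mapping.lookup m}))"
    using finite_gt_patterns finite_lr_patterns[OF \<sigma> \<rho>] by (simp add: card_SigmaI)
  also have "\<dots> = (\<Sum>g\<in>lr_patterns \<sigma> \<rho>. schur (?\<theta> g) m)"
    using schur_eq_card_gt_patterns[OF \<theta>(1) keys] by (intro sum.cong) auto
  finally show ?thesis
    unfolding schur_mult_coefficient[OF \<sigma> \<rho> keys] card[symmetric]
    by (simp add: case_prod_unfold mem_Times_iff)
qed

section \<open>Linear independence of Schur functions\<close>

lemma permuted_strictly_decreasing:
  fixes \<gamma> \<eta> :: "nat \<Rightarrow> nat"
  assumes w: "w permutes {..<n}" and eq: "\<gamma> \<circ> w = \<eta>"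
    and \<gamma>: "\<And>i j. i < j \<Longrightarrow> j < n \<Longrightarrow> \<gamma> j < \<gamma> i" and \<eta>: "\<And>i j. i < j \<Longrightarrow> j < n \<Longrightarrow> \<eta> j < \<eta> i"
  shows "w = id"
\<comment> \<open>Since \<open>\<gamma>\<close> and \<open>\<eta>\<close> both decrease strictly,
  \<open>w\<close> is increasing on \<open>{..<n}\<close>; therefore \<open>i \<le> w i\<close>,
  which forces the identity.\<close>
proof (rule permutes_natset_ge[OF w], clarify)
  have less: "w i < w j" if "i < j" "j < n" for i j
  proof (rule ccontr)
    assume "\<not> w i < w j"
    moreover have "w i < n" using permutes_in_image[OF w, of i] that by simp
    ultimately have "\<gamma> (w i) \<le> \<gamma> (w j)" using \<gamma>[of "w j" "w i"] by (cases "w i = w j") auto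
    with \<eta>[OF that] eq[symmetric] show False by simp
  qed
  fix i assume "i < n"
  then show "i \<le> w i"
  proof (induction i)
    case (Suc i)
    then show ?case using less[of i "Suc i"] by simp
  qed simp
qed

text \<open>Multiplying a relation by the Vandermonde determinant gives a relation among alternants.
  The monomial with exponents \<open>\<eta> v + staircase n v\<close> occurs only in the alternant
  of \<open>\<eta>\<close>, and only for the identity permutation.\<close>

lemma schur_linear_independent:
  fixes d :: "(nat \<Rightarrow> nat) \<Rightarrow> int"
  assumes fin: "finite \<Theta>" and part: "\<And>\<theta>. \<theta> \<in> \<Theta> \<Longrightarrow> is_partition \<theta>"
    and zero: "\<And>m. (\<Sum>\<theta>\<in>\<Theta>. d \<theta> * schur \<theta> m) = 0"
    and \<eta>: "\<eta> \<in> \<Theta>"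
  shows "d \<eta> = 0"
proof -
  define n where "n = (\<Sum>\<theta>\<in>\<Theta>. num_parts \<theta>)"
  have n: "\<theta> v = 0" if "\<theta> \<in> \<Theta>" "n \<le> v" for \<theta> v
   
    using partition_eq_0[OF part[OF that(1)], of v] member_le_sum[OF that(1), of num_parts] fin that(2)
    by (simp add: n_def)
  have anti: "antimono \<theta>" if "\<theta> \<in> \<Theta>" for \<theta>
    using part[OF that] by (simp add: is_partition_def)
  \<comment> \<open>Grouped by weight, the coefficient of each monomial is the assumed relation at
    that monomial.\<close>
  have poly0: "(\<Sum>\<theta>\<in>\<Theta>. of_int (d \<theta>) * schur_poly n \<theta> x) = 0" for x
  proof -
    let ?S = "SIGMA \<theta>:\<Theta>. gt_patterns n \<theta>"
    let ?w = "\<lambda>z. gt_weight (snd z)"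
    let ?f = "\<lambda>z. of_int (d (fst z)) * (\<Prod>v<n. x v ^ ?w z v) :: real"
    have finS: "finite ?S" using fin finite_gt_patterns by simp
    have "(\<Sum>\<theta>\<in>\<Theta>. of_int (d \<theta>) * schur_poly n \<theta> x) = sum ?f ?S"
      unfolding schur_poly_def sum_distrib_left using fin finite_gt_patterns
      by (subst sum.Sigma) (auto intro!: sum.cong)
    also have "\<dots> = (\<Sum>u\<in>?w ` ?S. \<Sum>z\<in>{z \<in> ?S. ?w z = u}. ?f z)"
      using finS by (intro sum.group[symmetric]) auto
    also have "\<dots> = 0"
    proof (rule sum.neutral, rule ballI)
      fix u assume "u \<in> ?w ` ?S"
      then obtain \<theta> g where g: "\<theta> \<in> \<Theta>" "g \<in> gt_patterns n \<theta>" "u = gt_weight g" by auto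
      then have supp: "{v. u v \<noteq> 0} \<subseteq> {..<n}"
        using gt_weight_support by simp
      then have "finite {v. u v \<noteq> 0}" by (rule finite_subset) simp
      then have m: "Poly_Mapping.lookup (Abs_poly_mapping u) = u"
        by (simp add: Abs_poly_mapping_inverse)
      with supp have keys: "Poly_Mapping.keys (Abs_poly_mapping u) \<subseteq> {..<n}"
        by (auto simp: in_keys_iff m)
      have "{z \<in> ?S. ?w z = u} = (SIGMA \<theta>:\<Theta>. {g \<in> gt_patterns n \<theta>. gt_weight g = u})" by auto
      then have "(\<Sum>z\<in>{z \<in> ?S. ?w z = u}. d (fst z))
          = (\<Sum>\<theta>\<in>\<Theta>. \<Sum>g\<in>{g \<in> gt_patterns n \<theta>. gt_weight g = u}. d \<theta>)"
        using fin finite_gt_patterns by (subst sum.Sigma) (auto intro!: sum.cong)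
      also have "\<dots> = (\<Sum>\<theta>\<in>\<Theta>. d \<theta> * schur \<theta> (Abs_poly_mapping u))"
        using schur_eq_card_gt_patterns[OF part keys] by (intro sum.cong) (auto simp: m)
      also have "\<dots> = 0" by (rule zero)
      finally have "(\<Sum>z\<in>{z \<in> ?S. ?w z = u}. d (fst z)) = 0" .
      moreover have "(\<Sum>z\<in>{z \<in> ?S. ?w z = u}. ?f z)
          = (\<Prod>v<n. x v ^ u v) * of_int (\<Sum>z\<in>{z \<in> ?S. ?w z = u}. d (fst z))"
        unfolding of_int_sum sum_distrib_left by (intro sum.cong) auto
      ultimately show "(\<Sum>z\<in>{z \<in> ?S. ?w z = u}. ?f z) = 0" by simp
    qed
    finally show ?thesis .
  qed
  let ?\<gamma> = "\<lambda>\<theta> v. \<theta> v + staircase n v"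
  let ?I = "\<Theta> \<times> {w. w permutes {..<n}}"
  \<comment> \<open>The comparison is with the empty family, that is, with the zero
    function.\<close>
  have "(\<Sum>z\<in>{z \<in> ?I. ?\<gamma> (fst z) \<circ> snd z = ?\<gamma> \<eta>}. of_int (d (fst z) * sign (snd z)) :: real) =
      (\<Sum>j\<in>{j \<in> {} :: unit set. (\<lambda>_. 0) = ?\<gamma> \<eta>}. 0)"
  proof (rule monomial_functions_independent[where n = n and I = ?I and J = "{} :: unit set"
        and p = "\<lambda>z. ?\<gamma> (fst z) \<circ> snd z" and q = "\<lambda>_ _. 0" and d = "\<lambda>_. 0"
        and e = "\<lambda>z. of_int (d (fst z) * sign (snd z))" and m = "?\<gamma> \<eta>"])
    show "finite ?I" using fin by (intro finite_cartesian_product finite_permutations) simp_all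
    show "(?\<gamma> (fst z) \<circ> snd z) v = 0" if "z \<in> ?I" "n \<le> v" for z v
    proof -
      have "snd z v = v" using that permutes_not_in[of "snd z" "{..<n}" v] by auto
      then show ?thesis using that n[of "fst z" v] by (auto simp: staircase_def)
    qed
    fix x :: "nat \<Rightarrow> real"
    have "(\<Sum>z\<in>?I. of_int (d (fst z) * sign (snd z)) * (\<Prod>v<n. x v ^ (?\<gamma> (fst z) \<circ> snd z) v))
        = (\<Sum>\<theta>\<in>\<Theta>. of_int (d \<theta>) * alternant n (?\<gamma> \<theta>) x)"
      unfolding alternant_def sum_distrib_left sum.cartesian_product
      by (intro sum.cong) (auto simp: mult.assoc)
    also have "\<dots> = (\<Sum>\<theta>\<in>\<Theta>. of_int (d \<theta>) * schur_poly n \<theta> x) * alternant n (staircase n) x"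
      unfolding sum_distrib_right using bialternant_formula[OF anti] n
      by (intro sum.cong) (auto simp: mult.assoc)
    finally show "(\<Sum>z\<in>?I. of_int (d (fst z) * sign (snd z)) * (\<Prod>v<n. x v ^ (?\<gamma> (fst z) \<circ> snd z) v))
        = (\<Sum>j\<in>({} :: unit set). 0 * (\<Prod>v<n. x v ^ 0))"
      by (simp add: poly0)
  qed auto
  moreover have "{z \<in> ?I. ?\<gamma> (fst z) \<circ> snd z = ?\<gamma> \<eta>} = {(\<eta>, id)}"
  proof (intro Set.set_eqI iffI)
    fix z assume z: "z \<in> {z \<in> ?I. ?\<gamma> (fst z) \<circ> snd z = ?\<gamma> \<eta>}"
    have dec: "?\<gamma> \<theta> j < ?\<gamma> \<theta> i" if "\<theta> \<in> \<Theta>" "i < j" "j < n" for \<theta> i j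
      using antimonoD[OF anti[OF that(1)], of i j] that by (simp add: staircase_def)
    have "snd z = id"
      using z by (intro permuted_strictly_decreasing[of _ n "?\<gamma> (fst z)" "?\<gamma> \<eta>"] dec \<eta>) auto
    moreover from this z have "fst z = \<eta>" by (auto simp: fun_eq_iff)
    ultimately show "z \<in> {(\<eta>, id)}" by (cases z) auto
  next
    fix z :: "(nat \<Rightarrow> nat) \<times> (nat \<Rightarrow> nat)" assume "z \<in> {(\<eta>, id)}"
    then show "z \<in> {z \<in> ?I. ?\<gamma> (fst z) \<circ> snd z = ?\<gamma> \<eta>}" using \<eta> by (auto simp: permutes_id)
  qed
  ultimately show ?thesis by simp
qed

section \<open>Adding a column\<close>

definition add_column :: "nat \<Rightarrow> (nat \<Rightarrow> nat) \<Rightarrow> nat \<Rightarrow> nat" where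
  "add_column k \<mu> i = \<mu> i + (if i < k then 1 else 0)"

lemma is_partition_add_column:
  assumes "is_partition \<mu>"
  shows "is_partition (add_column k \<mu>)"
proof -
  have "{i. add_column k \<mu> i \<noteq> 0} \<subseteq> {i. \<mu> i \<noteq> 0} \<union> {..<k}" by (auto simp: add_column_def)
  then have "finite {i. add_column k \<mu> i \<noteq> 0}"
    by (rule finite_subset) (use assms in \<open>simp add: is_partition_def\<close>)
  moreover have "add_column k \<mu> (Suc i) \<le> add_column k \<mu> i" for i
    using assms antimonoD[of \<mu> i "Suc i"] by (simp add: is_partition_def add_column_def)
  ultimately show ?thesis by (simp add: is_partition_def antimono_iff_le_Suc)
qed

lemma num_parts_le_iff:
  assumes "is_partition \<mu>"
  shows "num_parts \<mu> \<le> p \<longleftrightarrow> \<mu> p = 0"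
  using partition_nonzero_iff[OF assms, of p] by auto

text \<open>By column strictness a value occurs at most once in each of the \<open>\<rho> 0\<close>
  columns.\<close>

lemma weight_from_le:
  assumes g: "g \<in> gt_patterns n \<rho>" "antimono \<rho>"
  shows "weight_from g j v \<le> \<rho> 0"
proof -
  \<comment> \<open>The extra summand is the length of the next row. Interlacing bounds it by
    \<open>g v V\<close>, which makes the sum telescope.\<close>
  have "(\<Sum>r\<le>V. (g (Suc v) r - j) - (g v r - j)) + g (Suc v) (Suc V) \<le> g (Suc v) 0" for V
  proof (induction V)
    case 0
    then show ?case using gt_patterns_le_Suc[OF g(1), of v 0] gt_patterns_interlaces_left[OF g, of v 0]
      by simp
  next
    case (Suc V)
    then show ?case
     
      using gt_patterns_le_Suc[OF g(1), of v "Suc V"] gt_patterns_interlaces_left[OF g, of v "Suc V"]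
      by simp
  qed
  from this[of v] show ?thesis
    using gt_patterns_le_shape[OF g(1), of "Suc v" 0] by (simp add: weight_from_def)
qed

lemma lr_patterns_add_column_mono:
  "lr_patterns \<sigma> \<rho> \<subseteq> lr_patterns (add_column k \<sigma>) \<rho>"
proof
  fix g assume g: "g \<in> lr_patterns \<sigma> \<rho>"
  have "lr_good (add_column k \<sigma>) g"
    unfolding lr_good_def
  proof (intro allI)
    fix j i
    have "\<sigma> (Suc i) + weight_from g j (Suc i) \<le> \<sigma> i + weight_from g j i"
      using g by (auto simp: lr_patterns_def lr_good_def)
    then show "add_column k \<sigma> (Suc i) + weight_from g j (Suc i) \<le> add_column k \<sigma> i + weight_from g j i"
      by (simp add: add_column_def)
  qed
  with g show "g \<in> lr_patterns (add_column k \<sigma>) \<rho>" by (simp add: lr_patterns_def)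
qed

text \<open>The column alters only the condition at \<open>i = l\<close>. There the gap outweighs
  the at most \<open>\<rho> 0\<close> entries \<open>Suc l\<close>, so the condition holds with or
  without the column.\<close>

lemma lr_patterns_add_column_gap:
  assumes \<rho>: "antimono \<rho>" and gap: "\<rho> 0 + \<sigma> (Suc l) \<le> \<sigma> l"
  shows "lr_patterns (add_column (Suc l) \<sigma>) \<rho> = lr_patterns \<sigma> \<rho>"
proof
  show "lr_patterns (add_column (Suc l) \<sigma>) \<rho> \<subseteq> lr_patterns \<sigma> \<rho>"
  proof
    fix g assume g: "g \<in> lr_patterns (add_column (Suc l) \<sigma>) \<rho>"
    then obtain n where n: "g \<in> gt_patterns n \<rho>" by (auto simp: lr_patterns_def)
    have "lr_good \<sigma> g"
      unfolding lr_good_def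
    proof (intro allI)
      fix j i
      have "add_column (Suc l) \<sigma> (Suc i) + weight_from g j (Suc i)
          \<le> add_column (Suc l) \<sigma> i + weight_from g j i"
        using g by (auto simp: lr_patterns_def lr_good_def)
      then show "\<sigma> (Suc i) + weight_from g j (Suc i) \<le> \<sigma> i + weight_from g j i"
        using gap weight_from_le[OF n \<rho>, of j "Suc l"]
        by (cases "i = l") (auto simp: add_column_def split: if_splits)
    qed
    with g show "g \<in> lr_patterns \<sigma> \<rho>" by (simp add: lr_patterns_def)
  qed
qed (rule lr_patterns_add_column_mono)

section \<open>Littlewood--Richardson coefficients and Schur positivity\<close>

definition lr_coeff :: "(nat \<Rightarrow> nat) \<Rightarrow> (nat \<Rightarrow> nat) \<Rightarrow> (nat \<Rightarrow> nat) \<Rightarrow> nat" where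
  "lr_coeff \<sigma> \<rho> \<theta> = card {g \<in> lr_patterns \<sigma> \<rho>. (\<lambda>v. \<sigma> v + gt_weight g v) = \<theta>}"

lemma lr_coeff_support:
  assumes "is_partition \<sigma>" "is_partition \<rho>"
  shows "finite {\<theta>. lr_coeff \<sigma> \<rho> \<theta> \<noteq> 0}" and "lr_coeff \<sigma> \<rho> \<theta> \<noteq> 0 \<Longrightarrow> is_partition \<theta>"
proof -
  have ex: "\<exists>g\<in>lr_patterns \<sigma> \<rho>. (\<lambda>v. \<sigma> v + gt_weight g v) = \<theta>" if "lr_coeff \<sigma> \<rho> \<theta> \<noteq> 0" for \<theta>
  proof -
    have "{g \<in> lr_patterns \<sigma> \<rho>. (\<lambda>v. \<sigma> v + gt_weight g v) = \<theta>} \<noteq> {}"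
      using that unfolding lr_coeff_def by (metis card.empty)
    then show ?thesis by blast
  qed
  then have "{\<theta>. lr_coeff \<sigma> \<rho> \<theta> \<noteq> 0} \<subseteq> (\<lambda>g v. \<sigma> v + gt_weight g v) ` lr_patterns \<sigma> \<rho>" by blast
  then show "finite {\<theta>. lr_coeff \<sigma> \<rho> \<theta> \<noteq> 0}"
    by (rule finite_subset) (intro finite_imageI finite_lr_patterns assms)
  show "is_partition \<theta>" if "lr_coeff \<sigma> \<rho> \<theta> \<noteq> 0"
    using ex[OF that] is_partition_lr[OF assms(1)] by auto
qed

text \<open>\<open>\<Theta>\<close> may be any finite set containing the support, so that two
  products can be expanded over a common index set.\<close>

lemma schur_mult_lr_coeff:
  assumes \<sigma>: "is_partition \<sigma>" and \<rho>: "is_partition \<rho>"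
    and \<Theta>: "finite \<Theta>" "{\<theta>. lr_coeff \<sigma> \<rho> \<theta> \<noteq> 0} \<subseteq> \<Theta>"
  shows "(schur \<sigma> \<odot> schur \<rho>) m = (\<Sum>\<theta>\<in>\<Theta>. int (lr_coeff \<sigma> \<rho> \<theta>) * schur \<theta> m)"
proof -
  let ?t = "\<lambda>g v. \<sigma> v + gt_weight g v"
  have fin: "finite (lr_patterns \<sigma> \<rho>)" by (rule finite_lr_patterns[OF \<sigma> \<rho>])
  have sub: "?t ` lr_patterns \<sigma> \<rho> \<subseteq> \<Theta>"
  proof clarify
    fix g assume "g \<in> lr_patterns \<sigma> \<rho>"
    then have "g \<in> {h \<in> lr_patterns \<sigma> \<rho>. ?t h = ?t g}" by simp
    then have "lr_coeff \<sigma> \<rho> (?t g) \<noteq> 0"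
      unfolding lr_coeff_def using fin by (auto simp: card_eq_0_iff)
    then show "?t g \<in> \<Theta>" using \<Theta>(2) by blast
  qed
  have "(schur \<sigma> \<odot> schur \<rho>) m = (\<Sum>g\<in>lr_patterns \<sigma> \<rho>. schur (?t g) m)"
    by (rule schur_mult_eq_sum[OF \<sigma> \<rho>])
  also have "\<dots> = (\<Sum>\<theta>\<in>\<Theta>. \<Sum>g\<in>{g \<in> lr_patterns \<sigma> \<rho>. ?t g = \<theta>}. schur (?t g) m)"
    using sum.group[OF fin \<Theta>(1) sub, of "\<lambda>g. schur (?t g) m"] by simp
  also have "\<dots> = (\<Sum>\<theta>\<in>\<Theta>. int (lr_coeff \<sigma> \<rho> \<theta>) * schur \<theta> m)"
  proof (intro sum.cong refl)
    fix \<theta>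
    have "(\<Sum>g\<in>{g \<in> lr_patterns \<sigma> \<rho>. ?t g = \<theta>}. schur (?t g) m)
        = (\<Sum>g\<in>{g \<in> lr_patterns \<sigma> \<rho>. ?t g = \<theta>}. schur \<theta> m)" by (intro sum.cong) auto
    then show "(\<Sum>g\<in>{g \<in> lr_patterns \<sigma> \<rho>. ?t g = \<theta>}. schur (?t g) m) = int (lr_coeff \<sigma> \<rho> \<theta>) * schur \<theta> m"
      by (simp add: lr_coeff_def)
  qed
  finally show ?thesis .
qed

text \<open>By linear independence the coefficients of the difference are unique: any nonnegative
  expansion must consist of the differences of the Littlewood--Richardson coefficients.\<close>

lemma schur_positive_iff_lr_coeff:
  assumes \<sigma>: "is_partition \<sigma>" and \<rho>: "is_partition \<rho>" and \<mu>: "is_partition \<mu>" and \<nu>: "is_partition \<nu>"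
  shows "schur_positive (schur \<sigma> \<odot> schur \<rho> - schur \<mu> \<odot> schur \<nu>)
    \<longleftrightarrow> (\<forall>\<theta>. lr_coeff \<mu> \<nu> \<theta> \<le> lr_coeff \<sigma> \<rho> \<theta>)"
proof
  let ?S = "{\<theta>. lr_coeff \<sigma> \<rho> \<theta> \<noteq> 0} \<union> {\<theta>. lr_coeff \<mu> \<nu> \<theta> \<noteq> 0}"
  note fin = lr_coeff_support(1)[OF \<sigma> \<rho>] lr_coeff_support(1)[OF \<mu> \<nu>]
  note part = lr_coeff_support(2)[OF \<sigma> \<rho>] lr_coeff_support(2)[OF \<mu> \<nu>]
  {
    assume "schur_positive (schur \<sigma> \<odot> schur \<rho> - schur \<mu> \<odot> schur \<nu>)"
    then obtain c where c: "finite {\<theta>. c \<theta> \<noteq> 0}" "\<And>\<theta>. c \<theta> \<noteq> 0 \<Longrightarrow> is_partition \<theta>" "\<And>\<theta>. c \<theta> \<ge> 0"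
      and exp: "schur \<sigma> \<odot> schur \<rho> - schur \<mu> \<odot> schur \<nu> = (\<lambda>m. \<Sum>\<theta> | c \<theta> \<noteq> 0. c \<theta> * schur \<theta> m)"
      by (auto simp: schur_positive_def schur_expansion_def)
    define \<Theta> where "\<Theta> = ?S \<union> {\<theta>. c \<theta> \<noteq> 0}"
    have \<Theta>: "finite \<Theta>" using fin c(1) by (simp add: \<Theta>_def)
    have d: "int (lr_coeff \<sigma> \<rho> \<theta>) - int (lr_coeff \<mu> \<nu> \<theta>) - c \<theta> = 0" if "\<theta> \<in> \<Theta>" for \<theta>
    proof (rule schur_linear_independent[OF \<Theta> _ _ that])
      show "is_partition \<theta>" if "\<theta> \<in> \<Theta>" for \<theta> using that part c(2) by (auto simp: \<Theta>_def)
      fix m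
      have "(\<Sum>\<theta>\<in>\<Theta>. c \<theta> * schur \<theta> m) = (schur \<sigma> \<odot> schur \<rho> - schur \<mu> \<odot> schur \<nu>) m"
        unfolding exp using \<Theta> by (intro sum.mono_neutral_right) (auto simp: \<Theta>_def)
      also have "\<dots> = (\<Sum>\<theta>\<in>\<Theta>. int (lr_coeff \<sigma> \<rho> \<theta>) * schur \<theta> m)
          - (\<Sum>\<theta>\<in>\<Theta>. int (lr_coeff \<mu> \<nu> \<theta>) * schur \<theta> m)"
        using schur_mult_lr_coeff[OF \<sigma> \<rho> \<Theta>] schur_mult_lr_coeff[OF \<mu> \<nu> \<Theta>]
        by (simp add: \<Theta>_def le_supI1)
      finally show "(\<Sum>\<theta>\<in>\<Theta>. (int (lr_coeff \<sigma> \<rho> \<theta>) - int (lr_coeff \<mu> \<nu> \<theta>) - c \<theta>) * schur \<theta> m) = 0"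
        by (simp add: left_diff_distrib sum_subtractf)
    qed
    show "\<forall>\<theta>. lr_coeff \<mu> \<nu> \<theta> \<le> lr_coeff \<sigma> \<rho> \<theta>"
    proof
      fix \<theta>
      show "lr_coeff \<mu> \<nu> \<theta> \<le> lr_coeff \<sigma> \<rho> \<theta>"
        using d[of \<theta>] c(3)[of \<theta>] by (cases "\<theta> \<in> \<Theta>") (auto simp: \<Theta>_def)
    qed
  }
  assume le: "\<forall>\<theta>. lr_coeff \<mu> \<nu> \<theta> \<le> lr_coeff \<sigma> \<rho> \<theta>"
  define c where "c \<theta> = int (lr_coeff \<sigma> \<rho> \<theta>) - int (lr_coeff \<mu> \<nu> \<theta>)" for \<theta>
  have sub: "{\<theta>. c \<theta> \<noteq> 0} \<subseteq> ?S" by (auto simp: c_def)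
  have finS: "finite ?S" using fin by simp
  have "(schur \<sigma> \<odot> schur \<rho> - schur \<mu> \<odot> schur \<nu>) m = (\<Sum>\<theta> | c \<theta> \<noteq> 0. c \<theta> * schur \<theta> m)" for m
  proof -
    have "(schur \<sigma> \<odot> schur \<rho> - schur \<mu> \<odot> schur \<nu>) m
        = (\<Sum>\<theta>\<in>?S. int (lr_coeff \<sigma> \<rho> \<theta>) * schur \<theta> m) - (\<Sum>\<theta>\<in>?S. int (lr_coeff \<mu> \<nu> \<theta>) * schur \<theta> m)"
      using schur_mult_lr_coeff[OF \<sigma> \<rho> finS] schur_mult_lr_coeff[OF \<mu> \<nu> finS] by simp
    also have "\<dots> = (\<Sum>\<theta>\<in>?S. c \<theta> * schur \<theta> m)"
      by (simp add: c_def left_diff_distrib sum_subtractf)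
    also have "\<dots> = (\<Sum>\<theta> | c \<theta> \<noteq> 0. c \<theta> * schur \<theta> m)"
      using finS sub by (intro sum.mono_neutral_right) auto
    finally show ?thesis .
  qed
  then have "schur_expansion (schur \<sigma> \<odot> schur \<rho> - schur \<mu> \<odot> schur \<nu>) c"
    unfolding schur_expansion_def
    using finite_subset[OF sub finS] sub part by auto
  moreover have "c \<theta> \<ge> 0" for \<theta> using le by (simp add: c_def)
  ultimately show "schur_positive (schur \<sigma> \<odot> schur \<rho> - schur \<mu> \<odot> schur \<nu>)"
    unfolding schur_positive_def by blast
qed

lemma add_column_plus_weight_eq_iff:
  "(\<lambda>v. add_column k \<sigma> v + w v) = add_column k \<theta> \<longleftrightarrow> (\<lambda>v. \<sigma> v + w v) = \<theta>"
  by (auto simp: add_column_def fun_eq_iff)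

lemma lr_coeff_add_column_mono:
  assumes "is_partition \<sigma>" "is_partition \<rho>"
  shows "lr_coeff \<sigma> \<rho> \<theta> \<le> lr_coeff (add_column k \<sigma>) \<rho> (add_column k \<theta>)"
proof -
  have "finite (lr_patterns (add_column k \<sigma>) \<rho>)"
    using assms by (intro finite_lr_patterns is_partition_add_column)
  then show ?thesis
    unfolding lr_coeff_def add_column_plus_weight_eq_iff
    using lr_patterns_add_column_mono by (intro card_mono) auto
qed

lemma lr_coeff_add_column_gap:
  assumes "antimono \<rho>" "\<rho> 0 + \<sigma> (Suc l) \<le> \<sigma> l"
  shows "lr_coeff (add_column (Suc l) \<sigma>) \<rho> (add_column (Suc l) \<theta>) = lr_coeff \<sigma> \<rho> \<theta>"
  unfolding lr_coeff_def add_column_plus_weight_eq_iff lr_patterns_add_column_gap[of \<rho> \<sigma> l, OF assms] ..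

text \<open>Shapes in the product contain the left factor, so the column can be removed from each of
  them.\<close>

lemma lr_coeff_add_column_shape:
  assumes "lr_coeff (add_column k \<sigma>) \<rho> \<theta> \<noteq> 0"
  obtains \<theta>' where "\<theta> = add_column k \<theta>'"
proof -
  have "{g \<in> lr_patterns (add_column k \<sigma>) \<rho>. (\<lambda>v. add_column k \<sigma> v + gt_weight g v) = \<theta>} \<noteq> {}"
    using assms unfolding lr_coeff_def by (metis card.empty)
  then obtain g where "\<theta> = (\<lambda>v. add_column k \<sigma> v + gt_weight g v)" by blast
  then have "\<theta> = add_column k (\<lambda>v. \<sigma> v + gt_weight g v)" by (auto simp: add_column_def)
  then show ?thesis by (rule that)
qed

section \<open>Columns and the star operation\<close>

lemma star_add_column:
  assumes \<mu>: "is_partition \<mu>" "num_parts \<mu> \<le> p" and \<nu>: "is_partition \<nu>" "num_parts \<nu> \<le> p"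
    and l: "l < p" and big: "\<nu> 0 + p \<le> \<mu> l"
  shows "star_left (add_column (Suc l) \<mu>) \<nu> = add_column (Suc l) (star_left \<mu> \<nu>)"
    and "star_right (add_column (Suc l) \<mu>) \<nu> = star_right \<mu> \<nu>"
proof -
  let ?\<mu> = "add_column (Suc l) \<mu>"
  have anti: "antimono \<mu>" "antimono \<nu>" using \<mu> \<nu> by (auto simp: is_partition_def)
  have \<mu>': "is_partition ?\<mu>" by (rule is_partition_add_column[OF \<mu>(1)])
  have "\<mu> p = 0" using num_parts_le_iff[OF \<mu>(1)] \<mu>(2) by simp
  then have \<mu>'p: "num_parts ?\<mu> \<le> p"
    using num_parts_le_iff[OF \<mu>'] l by (simp add: add_column_def)
  \<comment> \<open>Every shifted part of \<open>\<mu>\<close> up to \<open>l\<close> exceeds all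
    shifted parts of \<open>\<nu>\<close>. Raising those parts further leaves every comparison in
    the star operation unchanged.\<close>
  have less: "int (\<nu> j) - int (Suc j) < int (\<mu> i) - int (Suc i)" if "i \<le> l" for i j
    using antimonoD[OF anti(1) that] antimonoD[OF anti(2), of 0 j] big l that by simp
  have left: "star_left_value p ?\<mu> \<nu> i = star_left_value p \<mu> \<nu> i + (if i < Suc l then 1 else 0)" for i
  proof (cases "i \<le> l")
    case True
    have "\<not> int (\<nu> j) - int (Suc j) \<ge> int (?\<mu> i) - int (Suc i)"
      "\<not> int (\<nu> j) - int (Suc j) \<ge> int (\<mu> i) - int (Suc i)" for j
      using less[OF True, of j] by (simp_all add: add_column_def)
    then have "star_left_value p ?\<mu> \<nu> i = int (?\<mu> i) - int (Suc i)"
      "star_left_value p \<mu> \<nu> i = int (\<mu> i) - int (Suc i)"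
      unfolding star_left_value_def by simp_all
    then show ?thesis using True by (simp add: add_column_def)
  qed (simp add: star_left_value_def add_column_def)
  have right: "star_right_value p ?\<mu> \<nu> j = star_right_value p \<mu> \<nu> j" for j
  proof -
    have "int (?\<mu> k) - int (Suc k) > int (\<nu> j) - int (Suc j)
        \<longleftrightarrow> int (\<mu> k) - int (Suc k) > int (\<nu> j) - int (Suc j)" for k
      using less[of k j] by (cases "k \<le> l") (auto simp: add_column_def)
    then show ?thesis by (simp only: star_right_value_def)
  qed
  have "star_left_upto p ?\<mu> \<nu> = add_column (Suc l) (star_left_upto p \<mu> \<nu>)"
    using left star_left_value_nonneg l
    by (auto simp: fun_eq_iff star_left_upto_def add_column_def nat_add_distrib)
  then show "star_left ?\<mu> \<nu> = add_column (Suc l) (star_left \<mu> \<nu>)"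
    using star_left_eq_upto[OF \<mu>' \<nu>(1) \<mu>'p \<nu>(2)] star_left_eq_upto[OF \<mu>(1) \<nu>(1) \<mu>(2) \<nu>(2)] by simp
  have "star_right_upto p ?\<mu> \<nu> = star_right_upto p \<mu> \<nu>"
    using right by (auto simp: fun_eq_iff star_right_upto_def)
  then show "star_right ?\<mu> \<nu> = star_right \<mu> \<nu>"
    using star_right_eq_upto[OF \<mu>' \<nu>(1) \<mu>'p \<nu>(2)] star_right_eq_upto[OF \<mu>(1) \<nu>(1) \<mu>(2) \<nu>(2)] by simp
qed

text \<open>The gap serves twice: it gives \<open>\<nu> 0 + p \<le> \<mu> l\<close> for the star
  operation, and a gap of at least \<open>\<nu> 0\<close> that fixes the coefficients of the
  subtracted product. Those of the other product can only grow.\<close>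

lemma schur_positive_add_column:
  assumes \<mu>: "is_partition \<mu>" "num_parts \<mu> \<le> p" and \<nu>: "is_partition \<nu>" "num_parts \<nu> \<le> p"
    and l: "l < p" and gap: "\<nu> 0 + p + \<mu> (Suc l) \<le> \<mu> l"
    and pos: "schur_positive (schur (star_left \<mu> \<nu>) \<odot> schur (star_right \<mu> \<nu>) - schur \<mu> \<odot> schur \<nu>)"
  defines "\<mu>' \<equiv> add_column (Suc l) \<mu>"
  shows "schur_positive (schur (star_left \<mu>' \<nu>) \<odot> schur (star_right \<mu>' \<nu>) - schur \<mu>' \<odot> schur \<nu>)"
proof -
  note star = is_partition_star[OF \<mu>(1) \<nu>(1)]
  have anti: "antimono \<nu>" using \<nu> by (simp add: is_partition_def)
  have star': "star_left \<mu>' \<nu> = add_column (Suc l) (star_left \<mu> \<nu>)" "star_right \<mu>' \<nu> = star_right \<mu> \<nu>"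
    unfolding \<mu>'_def using star_add_column[OF \<mu> \<nu> l] gap by auto
  have le: "lr_coeff \<mu> \<nu> \<theta> \<le> lr_coeff (star_left \<mu> \<nu>) (star_right \<mu> \<nu>) \<theta>" for \<theta>
    using pos schur_positive_iff_lr_coeff[OF star \<mu>(1) \<nu>(1)] by blast
  have "lr_coeff \<mu>' \<nu> \<theta> \<le> lr_coeff (star_left \<mu>' \<nu>) (star_right \<mu>' \<nu>) \<theta>" for \<theta>
  proof (cases "lr_coeff \<mu>' \<nu> \<theta> = 0")
    case False
    then obtain \<theta>' where \<theta>: "\<theta> = add_column (Suc l) \<theta>'"
      unfolding \<mu>'_def by (rule lr_coeff_add_column_shape)
    have "lr_coeff \<mu>' \<nu> \<theta> = lr_coeff \<mu> \<nu> \<theta>'"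
      unfolding \<mu>'_def \<theta> using gap by (intro lr_coeff_add_column_gap[OF anti]) simp
    also have "\<dots> \<le> lr_coeff (star_left \<mu> \<nu>) (star_right \<mu> \<nu>) \<theta>'" by (rule le)
    also have "\<dots> \<le> lr_coeff (star_left \<mu>' \<nu>) (star_right \<mu>' \<nu>) \<theta>"
      unfolding star' \<theta> by (rule lr_coeff_add_column_mono[OF star])
    finally show ?thesis .
  qed simp
  moreover have \<mu>': "is_partition \<mu>'" unfolding \<mu>'_def by (rule is_partition_add_column[OF \<mu>(1)])
  ultimately show ?thesis
    unfolding schur_positive_iff_lr_coeff[OF is_partition_star[OF \<mu>' \<nu>(1)] \<mu>' \<nu>(1)] by blast
qed

text \<open>Otherwise \<open>p\<close> steps of at most \<open>b\<close> each lead from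
  \<open>\<mu> 0\<close> to \<open>\<mu> p = 0\<close>, so that
  \<open>\<mu> 0 \<le> p * b\<close>.\<close>

lemma ex_large_gap:
  fixes \<mu> :: "nat \<Rightarrow> nat"
  assumes "\<mu> p = 0" "p * b < \<mu> 0"
  obtains l where "l < p" "b + \<mu> (Suc l) < \<mu> l"
proof -
  have "\<exists>l<p. b + \<mu> (Suc l) < \<mu> l"
  proof (rule ccontr)
    assume "\<not> ?thesis"
    then have step: "\<mu> l \<le> b + \<mu> (Suc l)" if "l < p" for l
      using that by (meson not_le)
    have "\<mu> 0 \<le> k * b + \<mu> k" if "k \<le> p" for k
      using that
    proof (induction k)
      case (Suc k)
      then show ?case using step[of k] by simp
    qed simp
    from this[of p] assms show False by simp
  qed
  with that show ?thesis by blast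
qed

theorem theorem3p2:
  fixes p :: nat and \<nu> :: "nat \<Rightarrow> nat"
  assumes "p > 0"
    and "is_partition \<nu>" and "num_parts \<nu> \<le> p"
    and "\<And>\<alpha>. is_partition \<alpha> \<Longrightarrow> num_parts \<alpha> \<le> p \<Longrightarrow> \<alpha> 0 \<le> p * (\<nu> 0 + p) \<Longrightarrow>
           schur_positive (schur (star_left \<alpha> \<nu>) \<odot> schur (star_right \<alpha> \<nu>) - schur \<alpha> \<odot> schur \<nu>)"
  shows "\<And>\<mu>. is_partition \<mu> \<Longrightarrow> num_parts \<mu> \<le> p \<Longrightarrow>
           schur_positive (schur (star_left \<mu> \<nu>) \<odot> schur (star_right \<mu> \<nu>) - schur \<mu> \<odot> schur \<nu>)"
proof -
  fix \<mu> :: "nat \<Rightarrow> nat"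
  assume "is_partition \<mu>" "num_parts \<mu> \<le> p"
  then show "schur_positive (schur (star_left \<mu> \<nu>) \<odot> schur (star_right \<mu> \<nu>) - schur \<mu> \<odot> schur \<nu>)"
  proof (induction "\<mu> 0" arbitrary: \<mu> rule: less_induct)
    case less
    show ?case
    proof (cases "\<mu> 0 \<le> p * (\<nu> 0 + p)")
      case True
      with less.prems show ?thesis by (intro assms(4))
    next
      case False
      have anti: "antimono \<mu>" using less.prems by (simp add: is_partition_def)
      have "\<mu> p = 0" using less.prems num_parts_le_iff by blast
      then obtain l where l: "l < p" "\<nu> 0 + p + \<mu> (Suc l) < \<mu> l"
        using False ex_large_gap[of \<mu> p "\<nu> 0 + p"] by auto
      \<comment> \<open>The column of length \<open>Suc l\<close> is removed. The subtraction is
        exact because the first \<open>Suc l\<close> parts are at least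
        \<open>\<mu> l > 0\<close>.\<close>
      define \<mu>' where "\<mu>' i = \<mu> i - (if i < Suc l then 1 else 0)" for i
      have ge: "\<mu> l \<le> \<mu> i" if "i < Suc l" for i using antimonoD[OF anti, of i l] that by simp
      have eq: "\<mu> = add_column (Suc l) \<mu>'"
      proof
        fix i show "\<mu> i = add_column (Suc l) \<mu>' i"
          using ge[of i] l by (auto simp: add_column_def \<mu>'_def)
      qed
      \<comment> \<open>Only at \<open>i = l\<close> does the removal act on one side alone; there
        the gap leaves room.\<close>
      have "\<mu>' (Suc i) \<le> \<mu>' i" for i
        using antimonoD[OF anti, of i "Suc i"] l by (cases "i = l") (auto simp: \<mu>'_def)
      moreover have "finite {i. \<mu>' i \<noteq> 0}"
        using less.prems(1) by (auto simp: is_partition_def \<mu>'_def elim!: rev_finite_subset)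
      ultimately have part: "is_partition \<mu>'" by (simp add: is_partition_def antimono_iff_le_Suc)
      have parts: "num_parts \<mu>' \<le> p"
        using \<open>\<mu> p = 0\<close> num_parts_le_iff[OF part] by (simp add: \<mu>'_def)
      have "\<mu>' 0 < \<mu> 0" using ge[of 0] l by (simp add: \<mu>'_def)
      from less.hyps[OF this part parts] show ?thesis
        unfolding eq using l
        by (intro schur_positive_add_column[OF part parts assms(2,3) l(1)]) (auto simp: \<mu>'_def)
    qed
  qed
qed

end
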